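(* Let $M$ be a von Neumann algebra of type I and let $e$ be a partial isometry of $M$. Then the Peirce 2-space $P_2(e)M$ is a $JW^*$-algebra of type I.
   Context: $M$ is regarded as a $JBW^*$-triple under $\{x,y,z\}=\frac12(xy^*z+zy^*x)$. For a partial isometry $e\in M$, the Peirce 2-projection is $P_2(e)x=\{e,\{e,x,e\},e\}=ee^*xe^*e$, and $P_2(e)M=ee^*Me^*e$ carries the Jordan product $x\circ y=\{x,e,y\}=\frac12(xe^*y+ye^*x)$, identity $e$ and involution $x^\sharp=ex^*e$. A $JW^*$-algebra is (up to Jordan $*$-isomorphism) a norm-closed subspace of a $C^*$-algebra, closed under the involution and the Jordan product $\frac12(xy+yx)$, which is a dual Banach space. A $JW^*$-algebra $A$ is of type I if, as a $JBW^*$-triple (with $\{x,y,z\}=(x\circ y^* )\circ z+(y^*\circ z)\circ x-(z\circ x)\circ y^*$), it contains a tripotent $u$ (i.e. $\{u,u,u\}=u$) which is abelian (i.e. $\{u,\{u,A,u\},u\}$ is associative under $\{x,u,y\}$) such that $A$ equals the weak* closed triple ideal generated by $u$; equivalently, its self-adjoint part is a type I $JBW$-algebra. *)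

theory Defs
  imports "HOL-Analysis.Analysis"
begin

section \<open>Complex normed spaces and complex Hilbert spaces\<close>

class scaleC =
  fixes scaleC :: "complex \<Rightarrow> 'a \<Rightarrow> 'a"  (infixr "*\<^sub>C" 75)

class complex_normed_space = real_normed_vector + scaleC +
  assumes scaleC_add_right: "c *\<^sub>C (x + y) = c *\<^sub>C x + c *\<^sub>C y"
    and scaleC_add_left: "(c + d) *\<^sub>C x = c *\<^sub>C x + d *\<^sub>C x"
    and scaleC_scaleC: "c *\<^sub>C d *\<^sub>C x = (c * d) *\<^sub>C x"
    and scaleR_scaleC: "r *\<^sub>R x = complex_of_real r *\<^sub>C x"
    and norm_scaleC: "norm (c *\<^sub>C x) = cmod c * norm x"

text \<open>The complex inner product is linear in the first argument. Definiteness, and the fact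
  that the norm is induced by it, are inherited from \<^class>\<open>real_inner\<close>, whose
  inner product is its real part.\<close>

class complex_hilbert_space = complex_normed_space + real_inner + banach +
  fixes cinner :: "'a \<Rightarrow> 'a \<Rightarrow> complex"
  assumes cinner_add_left: "cinner (x + y) z = cinner x z + cinner y z"
    and cinner_scaleC_left: "cinner (c *\<^sub>C x) y = c * cinner x y"
    and cinner_commute: "cinner y x = cnj (cinner x y)"
    and inner_eq_Re_cinner: "inner x y = Re (cinner x y)"

lemma scaleC_zero_right [simp]: "c *\<^sub>C 0 = (0 :: 'a :: complex_normed_space)"
  using scaleC_add_right[of c 0 "0 :: 'a"] by simp

lemma scaleC_one [simp]: "1 *\<^sub>C x = (x :: 'a :: complex_normed_space)"
  using scaleR_scaleC[of 1 x] by simp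

lemma scaleC_scaleR: "c *\<^sub>C r *\<^sub>R x = r *\<^sub>R c *\<^sub>C (x :: 'a :: complex_normed_space)"
  by (simp add: scaleR_scaleC scaleC_scaleC mult.commute)

lemma bounded_linear_scaleC: "bounded_linear (\<lambda>x :: 'a :: complex_normed_space. c *\<^sub>C x)"
  by (rule bounded_linear_intro[of _ "cmod c"])
     (simp_all add: scaleC_add_right scaleC_scaleR norm_scaleC mult.commute)

lemma cinner_eq: "cinner x y = Complex (inner x y) (inner x (\<i> *\<^sub>C (y :: 'a :: complex_hilbert_space)))"
proof -
  have "cinner x (\<i> *\<^sub>C y) = - \<i> * cinner x y"
    using cinner_commute[of x "\<i> *\<^sub>C y"] cinner_commute[of x y]
    by (simp add: cinner_scaleC_left)
  then show ?thesis
    by (simp add: complex_eq_iff inner_eq_Re_cinner)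
qed

section \<open>C*-algebras\<close>

class star =
  fixes star :: "'a \<Rightarrow> 'a"

class cstar_algebra = complex_normed_space + banach + real_normed_algebra + star +
  assumes scaleC_mult_left: "(c *\<^sub>C x) * y = c *\<^sub>C (x * y)"
    and scaleC_mult_right: "x * (c *\<^sub>C y) = c *\<^sub>C (x * y)"
    and star_add: "star (x + y) = star x + star y"
    and star_scaleC: "star (c *\<^sub>C x) = cnj c *\<^sub>C star x"
    and star_mult: "star (x * y) = star y * star x"
    and star_star: "star (star x) = x"
    and norm_star_mult: "norm (star x * x) = (norm x)\<^sup>2"

section \<open>Bounded operators on a complex Hilbert space\<close>

typedef (overloaded) ('h :: complex_hilbert_space) bop =
  "{f :: 'h \<Rightarrow>\<^sub>L 'h. \<forall>c x. blinfun_apply f (c *\<^sub>C x) = c *\<^sub>C blinfun_apply f x}"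
  morphisms blinfun_of_bop bop_of_blinfun
  by (rule exI[of _ 0]) simp

setup_lifting type_definition_bop

lift_definition bop_apply :: "'h :: complex_hilbert_space bop \<Rightarrow> 'h \<Rightarrow> 'h" is blinfun_apply .

lemma bop_apply_scaleC: "bop_apply f (c *\<^sub>C x) = c *\<^sub>C bop_apply f x"
  by transfer simp

lemma bop_eqI: "(\<And>x. bop_apply f x = bop_apply g x) \<Longrightarrow> f = g"
  by transfer (rule blinfun_eqI)

lemma bounded_linear_bop_apply: "bounded_linear (bop_apply f)"
  by transfer (rule blinfun.bounded_linear_right)

instantiation bop :: (complex_hilbert_space) real_normed_vector
begin

lift_definition norm_bop :: "'a bop \<Rightarrow> real" is norm .
lift_definition zero_bop :: "'a bop" is 0 by simp
lift_definition plus_bop :: "'a bop \<Rightarrow> 'a bop \<Rightarrow> 'a bop" is "(+)"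
  by (simp add: blinfun.add_left scaleC_add_right)
lift_definition uminus_bop :: "'a bop \<Rightarrow> 'a bop" is "uminus"
  by (simp add: blinfun.minus_left bounded_linear.linear bounded_linear_scaleC linear_neg)
lift_definition minus_bop :: "'a bop \<Rightarrow> 'a bop \<Rightarrow> 'a bop" is "(-)"
  by (simp add: blinfun.diff_left bounded_linear.linear bounded_linear_scaleC linear_diff)
lift_definition scaleR_bop :: "real \<Rightarrow> 'a bop \<Rightarrow> 'a bop" is "(*\<^sub>R)"
  by (simp add: blinfun.scaleR_left scaleC_scaleR)

definition dist_bop :: "'a bop \<Rightarrow> 'a bop \<Rightarrow> real"
  where "dist_bop a b = norm (a - b)"
definition [code del]:
  "(uniformity :: ('a bop \<times> 'a bop) filter) = (INF e\<in>{0 <..}. principal {(x, y). dist x y < e})"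
definition open_bop :: "'a bop set \<Rightarrow> bool"
  where [code del]: "open_bop S = (\<forall>x\<in>S. \<forall>\<^sub>F (x', y) in uniformity. x' = x \<longrightarrow> y \<in> S)"
definition sgn_bop :: "'a bop \<Rightarrow> 'a bop"
  where "sgn_bop x = scaleR (inverse (norm x)) x"

instance
  apply standard
  unfolding dist_bop_def open_bop_def sgn_bop_def uniformity_bop_def
                 apply (rule refl | (transfer, force simp: norm_triangle_ineq algebra_simps))+
  done

end

lemma bop_apply_zero [simp]: "bop_apply 0 x = 0"
  by transfer simp
lemma bop_apply_add [simp]: "bop_apply (f + g) x = bop_apply f x + bop_apply g x"
  by transfer (simp add: blinfun.add_left)
lemma bop_apply_minus [simp]: "bop_apply (- f) x = - bop_apply f x"
  by transfer (simp add: blinfun.minus_left)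
lemma bop_apply_diff [simp]: "bop_apply (f - g) x = bop_apply f x - bop_apply g x"
  by transfer (simp add: blinfun.diff_left)
lemma bop_apply_scaleR [simp]: "bop_apply (r *\<^sub>R f) x = r *\<^sub>R bop_apply f x"
  by transfer (simp add: blinfun.scaleR_left)

lemma norm_bop_apply: "norm (bop_apply f x) \<le> norm f * norm x"
  by transfer (rule norm_blinfun)
lemma norm_bop_bound: "0 \<le> b \<Longrightarrow> (\<And>x. norm (bop_apply f x) \<le> b * norm x) \<Longrightarrow> norm f \<le> b"
  by transfer (rule norm_blinfun_bound)

instance bop :: (complex_hilbert_space) banach
proof
  fix X :: "nat \<Rightarrow> 'a bop"
  assume X: "Cauchy X"
  have dist_eq: "dist (blinfun_of_bop f) (blinfun_of_bop g) = dist f g" for f g :: "'a bop"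
    unfolding dist_norm by transfer simp
  have "Cauchy (\<lambda>n. blinfun_of_bop (X n))"
    using X unfolding Cauchy_def dist_eq .
  then obtain L where L: "(\<lambda>n. blinfun_of_bop (X n)) \<longlonglongrightarrow> L"
    by (meson Cauchy_convergent_iff convergent_def)
  have lim: "(\<lambda>n. blinfun_apply (blinfun_of_bop (X n)) x) \<longlonglongrightarrow> blinfun_apply L x" for x
    by (rule bounded_linear.tendsto[OF blinfun.bounded_linear_left L])
  have "blinfun_apply L (c *\<^sub>C x) = c *\<^sub>C blinfun_apply L x" for c x
  proof (rule LIMSEQ_unique)
    show "(\<lambda>n. blinfun_apply (blinfun_of_bop (X n)) (c *\<^sub>C x)) \<longlonglongrightarrow> blinfun_apply L (c *\<^sub>C x)"
      by (rule lim)
    show "(\<lambda>n. blinfun_apply (blinfun_of_bop (X n)) (c *\<^sub>C x)) \<longlonglongrightarrow> c *\<^sub>C blinfun_apply L x"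
    proof -
      have "blinfun_apply (blinfun_of_bop (X n)) (c *\<^sub>C x) = c *\<^sub>C blinfun_apply (blinfun_of_bop (X n)) x"
        for n
        using blinfun_of_bop[of "X n"] by simp
      then show ?thesis
        using bounded_linear.tendsto[OF bounded_linear_scaleC[of c] lim[of x]] by simp
    qed
  qed
  then have "blinfun_of_bop (bop_of_blinfun L) = L"
    by (intro bop_of_blinfun_inverse) simp
  with L have "X \<longlonglongrightarrow> bop_of_blinfun L"
    unfolding lim_sequentially dist_eq[symmetric] by simp
  then show "convergent X"
    by (auto simp: convergent_def)
qed

instantiation bop :: (complex_hilbert_space) complex_normed_space
begin

lift_definition scaleC_bop :: "complex \<Rightarrow> 'a bop \<Rightarrow> 'a bop" is
  "\<lambda>c f. Blinfun (\<lambda>x. c *\<^sub>C blinfun_apply f x)"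
  by (subst (1 2) bounded_linear_Blinfun_apply,
      auto intro!: bounded_linear_compose[OF bounded_linear_scaleC blinfun.bounded_linear_right]
        simp: scaleC_scaleC mult.commute)

lemma bop_apply_scaleC_left: "bop_apply (c *\<^sub>C f) x = c *\<^sub>C bop_apply f x"
proof -
  have "bounded_linear (\<lambda>x. c *\<^sub>C blinfun_apply (blinfun_of_bop f) x)"
    by (rule bounded_linear_compose[OF bounded_linear_scaleC blinfun.bounded_linear_right])
  then show ?thesis
    by (simp add: bop_apply.rep_eq scaleC_bop.rep_eq bounded_linear_Blinfun_apply)
qed

instance
proof
  fix c d :: complex and r :: real and x y :: "'a bop"
  have le: "norm (c *\<^sub>C x) \<le> cmod c * norm x" for c and x :: "'a bop"
    by (rule norm_bop_bound)
       (auto simp: bop_apply_scaleC_left norm_scaleC mult.assoc intro!: mult_left_mono norm_bop_apply)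
  show "c *\<^sub>C (x + y) = c *\<^sub>C x + c *\<^sub>C y"
    by (rule bop_eqI) (simp add: bop_apply_scaleC_left scaleC_add_right)
  show "(c + d) *\<^sub>C x = c *\<^sub>C x + d *\<^sub>C x"
    by (rule bop_eqI) (simp add: bop_apply_scaleC_left scaleC_add_left)
  show scale: "c *\<^sub>C d *\<^sub>C x = (c * d) *\<^sub>C x" for c d and x :: "'a bop"
    by (rule bop_eqI) (simp add: bop_apply_scaleC_left scaleC_scaleC)
  show real: "r *\<^sub>R x = complex_of_real r *\<^sub>C x" for r and x :: "'a bop"
    by (rule bop_eqI) (simp add: bop_apply_scaleC_left scaleR_scaleC)
  show "norm (c *\<^sub>C x) = cmod c * norm x"
  proof (cases "c = 0")
    case True
    then show ?thesis using real[of 0 x] by simp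
  next
    case False
    have "inverse c *\<^sub>C c *\<^sub>C x = x"
      using False real[of 1 x] by (simp add: scale)
    then have "norm x \<le> cmod (inverse c) * norm (c *\<^sub>C x)"
      using le[of "inverse c" "c *\<^sub>C x"] by simp
    then have "cmod c * norm x \<le> cmod c * (cmod (inverse c) * norm (c *\<^sub>C x))"
      by (intro mult_left_mono) simp_all
    also have "\<dots> = norm (c *\<^sub>C x)"
      using False by (simp add: norm_inverse)
    finally have "cmod c * norm x \<le> norm (c *\<^sub>C x)" .
    then show ?thesis using le[of c x] by simp
  qed
qed

end

subsection \<open>Existence of the adjoint\<close>

lemma hilbert_riesz:
  fixes f :: "'h :: {real_inner, banach} \<Rightarrow> real"
  assumes f: "bounded_linear f"
  shows "\<exists>y. \<forall>x. f x = inner y x"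
proof -
  interpret f: bounded_linear f by fact
  define J where "J x = (norm x)\<^sup>2 - 2 * f x" for x
  obtain K where K: "\<And>x. norm (f x) \<le> norm x * K" "K > 0"
    using f.pos_bounded by blast
  have "- K\<^sup>2 \<le> J x" for x
  proof -
    have "f x \<le> norm x * K" using K(1)[of x] by simp
    moreover have "0 \<le> (norm x - K)\<^sup>2" by simp
    ultimately show ?thesis unfolding J_def power2_diff by (simp add: mult.commute)
  qed
  then have bdd: "bdd_below (range J)" by (auto simp: bdd_below_def)
  define m where "m = (INF x. J x)"
  have m_le: "m \<le> J x" for x
    unfolding m_def by (rule cINF_lower[OF bdd]) simp
  have "\<exists>x. J x < m + 1 / real (Suc n)" for n
  proof -
    have "(INF x. J x) < m + 1 / real (Suc n)"
      by (simp add: m_def[symmetric])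
    then show ?thesis using cINF_less_iff[OF _ bdd] by auto
  qed
  then obtain X where X: "\<And>n. J (X n) < m + 1 / real (Suc n)" by metis
  have par: "(norm (x - y))\<^sup>2 = 2 * J x + 2 * J y - 4 * J ((1 / 2) *\<^sub>R (x + y))" for x y
    unfolding J_def
    by (simp add: power2_norm_eq_inner f.scaleR f.add inner_add inner_diff inner_commute algebra_simps)
  have near: "(norm (X i - X j))\<^sup>2 \<le> 2 / real (Suc i) + 2 / real (Suc j)" for i j
    using par[of "X i" "X j"] X[of i] X[of j] m_le[of "(1 / 2) *\<^sub>R (X i + X j)"] by simp
  have "Cauchy X"
  proof (rule metric_CauchyI)
    fix e :: real assume e: "0 < e"
    obtain N where N: "4 / e\<^sup>2 < real (Suc N)"
      by (meson less_Suc_eq of_nat_less_iff order.strict_trans reals_Archimedean2 lessI)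
    have "dist (X i) (X j) < e" if "N \<le> i" "N \<le> j" for i j
    proof -
      have "2 / real (Suc i) \<le> 2 / real (Suc N)" "2 / real (Suc j) \<le> 2 / real (Suc N)"
        using that by (simp_all add: frac_le)
      then have "(norm (X i - X j))\<^sup>2 \<le> 4 / real (Suc N)" using near[of i j] by simp
      also have "\<dots> < e\<^sup>2" using N e by (simp add: field_simps)
      finally show ?thesis using e by (simp add: dist_norm power2_less_imp_less)
    qed
    then show "\<exists>N. \<forall>i\<ge>N. \<forall>j\<ge>N. dist (X i) (X j) < e" by blast
  qed
  then obtain y where y: "X \<longlonglongrightarrow> y"
    by (meson Cauchy_convergent_iff convergent_def)
  have "(\<lambda>n. J (X n)) \<longlonglongrightarrow> J y"
    unfolding J_def by (intro tendsto_intros y f.tendsto)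
  moreover have "(\<lambda>n. m + 1 / real (Suc n)) \<longlonglongrightarrow> m + 0"
    using LIMSEQ_inverse_real_of_nat
    by (intro tendsto_intros) (simp add: inverse_eq_divide)
  ultimately have "J y \<le> m + 0"
    by (rule LIMSEQ_le) (use X less_imp_le in blast)
  then have min: "J y \<le> J x" for x using m_le[of x] by simp
  have "f x = inner y x" for x
  proof (cases "x = 0")
    case False
    define d where "d = f x - inner y x"
    define t where "t = d / (norm x)\<^sup>2"
    have "J (y + t *\<^sub>R x) = J y + t\<^sup>2 * (norm x)\<^sup>2 - 2 * t * d"
      unfolding J_def d_def power2_norm_eq_inner f.add f.scaleR
      by (simp add: inner_add inner_commute power2_eq_square algebra_simps)
    moreover have "t\<^sup>2 * (norm x)\<^sup>2 = t * d"
      using False by (simp add: t_def power2_eq_square)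
    ultimately have "t * d \<le> 0" using min[of "y + t *\<^sub>R x"] by (simp add: mult.commute)
    then have "t * d * (norm x)\<^sup>2 \<le> 0" by (simp add: mult_nonpos_nonneg)
    then have "d\<^sup>2 \<le> 0" using False by (simp add: t_def power2_eq_square)
    then show ?thesis by (simp add: d_def)
  qed simp
  then show ?thesis by blast
qed

lemma ex_bop_adjoint:
  fixes T :: "'h :: complex_hilbert_space bop"
  shows "\<exists>S. \<forall>x y. cinner (bop_apply T x) y = cinner x (bop_apply S y)"
proof -
  interpret T: bounded_linear "bop_apply T" by (rule bounded_linear_bop_apply)
  have "\<exists>z. \<forall>x. inner (bop_apply T x) y = inner z x" for y
    by (rule hilbert_riesz)
       (rule bounded_linear_compose[OF bounded_linear_inner_left bounded_linear_bop_apply])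
  then obtain S where S: "\<And>x y. inner (bop_apply T x) y = inner x (S y)"
    by (metis inner_commute)
  have uniq: "u = v" if "\<And>x. inner x u = inner x v" for u v :: 'h
  proof -
    have "inner (u - v) (u - v) = 0" using that[of "u - v"] by (simp add: inner_diff_right)
    then show ?thesis by simp
  qed
  have icm: "inner x (c *\<^sub>C y) = inner (cnj c *\<^sub>C x) y" for c and x y :: 'h
    using cinner_commute[of x "c *\<^sub>C y"] cinner_commute[of x y]
    by (simp add: inner_eq_Re_cinner cinner_scaleC_left)
  have add: "S (x + y) = S x + S y" for x y
    by (rule uniq) (simp add: S[symmetric] inner_add_right)
  have scale: "S (c *\<^sub>C y) = c *\<^sub>C S y" for c y
    by (rule uniq) (simp add: S[symmetric] icm bop_apply_scaleC[symmetric])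
  have bound: "norm (S y) \<le> norm y * norm T" for y
  proof (cases "S y = 0")
    case False
    have "(norm (S y))\<^sup>2 = inner (bop_apply T (S y)) y"
      by (simp add: S power2_norm_eq_inner)
    also have "\<dots> \<le> norm (bop_apply T (S y)) * norm y" by (rule norm_cauchy_schwarz)
    also have "\<dots> \<le> (norm T * norm (S y)) * norm y"
      by (intro mult_right_mono norm_bop_apply) simp
    finally show ?thesis using False by (simp add: power2_eq_square mult_ac)
  qed simp
  have "bounded_linear S"
    by (rule bounded_linear_intro[of _ "norm T"]) (simp_all add: add scaleR_scaleC scale bound)
  then have "blinfun_apply (Blinfun S) = S" by (rule bounded_linear_Blinfun_apply)
  then have "bop_apply (bop_of_blinfun (Blinfun S)) = S"
    by (simp add: bop_apply.rep_eq bop_of_blinfun_inverse scale)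
  moreover have "cinner (bop_apply T x) y = cinner x (S y)" for x y
    by (simp add: cinner_eq S scale[symmetric])
  ultimately show ?thesis by metis
qed

instantiation bop :: (complex_hilbert_space) cstar_algebra
begin

lift_definition times_bop :: "'a bop \<Rightarrow> 'a bop \<Rightarrow> 'a bop" is "(o\<^sub>L)"
  by simp

definition star_bop :: "'a bop \<Rightarrow> 'a bop" where
  "star_bop T = (SOME S. \<forall>x y. cinner (bop_apply T x) y = cinner x (bop_apply S y))"

lemma bop_apply_mult [simp]: "bop_apply (S * T) x = bop_apply S (bop_apply T x)"
  by transfer simp

lemma cinner_star: "cinner (bop_apply T x) y = cinner x (bop_apply (star T) y)"
  unfolding star_bop_def using someI_ex[OF ex_bop_adjoint[of T]] by blast

lemma star_bopI:
  assumes "\<And>x y. cinner (bop_apply T x) y = cinner x (bop_apply S y)"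
  shows "star T = S"
proof (rule bop_eqI)
  fix y
  have "inner x (bop_apply (star T) y) = inner x (bop_apply S y)" for x
    using assms[of x y] by (simp add: inner_eq_Re_cinner cinner_star)
  then have "inner (bop_apply (star T) y - bop_apply S y) (bop_apply (star T) y - bop_apply S y) = 0"
    by (simp add: inner_diff_right)
  then show "bop_apply (star T) y = bop_apply S y" by simp
qed

instance
proof
  fix x y z :: "'a bop" and c :: complex and r :: real
  note lin = bounded_linear.linear[OF bounded_linear_bop_apply]
  have radd: "cinner u (v + w) = cinner u v + cinner u w" for u v w :: 'a
    using cinner_commute[of u "v + w"] cinner_commute[of u v] cinner_commute[of u w]
    by (simp add: cinner_add_left)
  have rscale: "cinner u (c *\<^sub>C v) = cnj c * cinner u v" for c and u v :: 'a
    using cinner_commute[of u "c *\<^sub>C v"] cinner_commute[of u v]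
    by (simp add: cinner_scaleC_left)
  show "(x * y) * z = x * (y * z)" by (rule bop_eqI) simp
  show "(x + y) * z = x * z + y * z" by (rule bop_eqI) simp
  show "x * (y + z) = x * y + x * z" by (rule bop_eqI) (simp add: linear_add[OF lin])
  show "(r *\<^sub>R x) * y = r *\<^sub>R (x * y)" by (rule bop_eqI) simp
  show "x * (r *\<^sub>R y) = r *\<^sub>R (x * y)" by (rule bop_eqI) (simp add: linear_scale[OF lin])
  show norm_mult: "norm (x * y) \<le> norm x * norm y" for x y :: "'a bop"
    by transfer (rule norm_blinfun_compose)
  show "(c *\<^sub>C x) * y = c *\<^sub>C (x * y)" by (rule bop_eqI) (simp add: bop_apply_scaleC_left)
  show "x * (c *\<^sub>C y) = c *\<^sub>C (x * y)"
    by (rule bop_eqI) (simp add: bop_apply_scaleC_left bop_apply_scaleC)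
  show "star (x + y) = star x + star y"
    by (rule star_bopI) (simp add: cinner_add_left cinner_star radd)
  show "star (c *\<^sub>C x) = cnj c *\<^sub>C star x"
    by (rule star_bopI) (simp add: bop_apply_scaleC_left cinner_scaleC_left cinner_star rscale)
  show "star (x * y) = star y * star x"
    by (rule star_bopI) (simp add: cinner_star)
  show star_star: "star (star x) = x" for x :: "'a bop"
    by (rule star_bopI) (metis cinner_commute cinner_star)
  have sq: "(norm x)\<^sup>2 \<le> norm (star x * x)" for x :: "'a bop"
  proof -
    have "norm (bop_apply x v) \<le> sqrt (norm (star x * x)) * norm v" for v
    proof -
      have "(norm (bop_apply x v))\<^sup>2 = inner v (bop_apply (star x * x) v)"
        by (simp add: power2_norm_eq_inner inner_eq_Re_cinner cinner_star)
      also have "\<dots> \<le> norm v * norm (bop_apply (star x * x) v)" by (rule norm_cauchy_schwarz)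
      also have "\<dots> \<le> norm v * (norm (star x * x) * norm v)"
        by (intro mult_left_mono norm_bop_apply) simp
      also have "\<dots> = (sqrt (norm (star x * x)) * norm v)\<^sup>2"
        by (simp add: power_mult_distrib power2_eq_square)
      finally show ?thesis by (rule power2_le_imp_le) simp
    qed
    then have "norm x \<le> sqrt (norm (star x * x))" by (intro norm_bop_bound) auto
    then show ?thesis by (simp add: real_le_rsqrt sqrt_ge_absD)
  qed
  have le: "norm x \<le> norm (star x)" for x :: "'a bop"
  proof (cases "norm x = 0")
    case False
    have "norm x * norm x \<le> norm (star x) * norm x"
      using sq[of x] norm_mult[of "star x" x] by (simp add: power2_eq_square)
    then show ?thesis using False by (simp add: mult_le_cancel_right)
  qed simp
  have "norm (star x) = norm x" using le[of x] le[of "star x"] star_star[of x] by simp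
  then show "norm (star x * x) = (norm x)\<^sup>2"
    using sq[of x] norm_mult[of "star x" x] by (simp add: power2_eq_square)
qed

end

section \<open>Von Neumann algebras\<close>

definition csubspace :: "'a :: complex_normed_space set \<Rightarrow> bool" where
  "csubspace A \<longleftrightarrow> 0 \<in> A \<and> (\<forall>x\<in>A. \<forall>y\<in>A. x + y \<in> A) \<and> (\<forall>c. \<forall>x\<in>A. c *\<^sub>C x \<in> A)"

definition commutant :: "'h :: complex_hilbert_space bop set \<Rightarrow> 'h bop set" where
  "commutant M = {y. \<forall>x\<in>M. x * y = y * x}"

text \<open>Being equal to its bicommutant forces \<open>M\<close> to contain the identity operator.\<close>

definition von_neumann_algebra :: "'h :: complex_hilbert_space bop set \<Rightarrow> bool" where
  "von_neumann_algebra M \<longleftrightarrow>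
     csubspace M \<and> (\<forall>x\<in>M. \<forall>y\<in>M. x * y \<in> M) \<and> (\<forall>x\<in>M. star x \<in> M) \<and>
     commutant (commutant M) = M"

definition projection :: "'a :: cstar_algebra \<Rightarrow> bool" where
  "projection p \<longleftrightarrow> star p = p \<and> p * p = p"

definition partial_isometry :: "'a :: cstar_algebra \<Rightarrow> bool" where
  "partial_isometry e \<longleftrightarrow> projection (star e * e)"

definition central_projection :: "'a :: cstar_algebra set \<Rightarrow> 'a \<Rightarrow> bool" where
  "central_projection M z \<longleftrightarrow> z \<in> M \<and> projection z \<and> (\<forall>x\<in>M. z * x = x * z)"

definition abelian_projection :: "'a :: cstar_algebra set \<Rightarrow> 'a \<Rightarrow> bool" where
  "abelian_projection M p \<longleftrightarrow> p \<in> M \<and> projection p \<and>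
     (\<forall>x\<in>M. \<forall>y\<in>M. (p * x * p) * (p * y * p) = (p * y * p) * (p * x * p))"

text \<open>Every nonzero central projection majorizes a nonzero abelian one; for projections,
  \<open>p \<le> z\<close> means \<open>z * p = p\<close>.\<close>

definition type_I :: "'h :: complex_hilbert_space bop set \<Rightarrow> bool" where
  "type_I M \<longleftrightarrow> (\<forall>z. central_projection M z \<and> z \<noteq> 0 \<longrightarrow>
     (\<exists>p. abelian_projection M p \<and> p \<noteq> 0 \<and> z * p = p))"

section \<open>Peirce 2-spaces\<close>

definition cstar_triple :: "'a :: cstar_algebra \<Rightarrow> 'a \<Rightarrow> 'a \<Rightarrow> 'a" where
  "cstar_triple x y z = (1 / 2) *\<^sub>R (x * star y * z + z * star y * x)"

definition peirce2_proj :: "'a :: cstar_algebra \<Rightarrow> 'a \<Rightarrow> 'a" where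
  "peirce2_proj e x = cstar_triple e (cstar_triple e x e) e"

definition peirce2 :: "'a :: cstar_algebra \<Rightarrow> 'a set \<Rightarrow> 'a set" where
  "peirce2 e M = peirce2_proj e ` M"

definition peirce2_prod :: "'a :: cstar_algebra \<Rightarrow> 'a \<Rightarrow> 'a \<Rightarrow> 'a" where
  "peirce2_prod e x y = cstar_triple x e y"

definition peirce2_star :: "'a :: cstar_algebra \<Rightarrow> 'a \<Rightarrow> 'a" where
  "peirce2_star e x = e * star x * e"

section \<open>Dual Banach spaces and the weak* topology\<close>

text \<open>The bounded complex-linear functionals on a subspace \<open>A\<close>, represented by total functions
  that vanish off \<open>A\<close>, so that equality of functionals on \<open>A\<close> is equality of functions.\<close>

definition dual_space :: "'a :: complex_normed_space set \<Rightarrow> ('a \<Rightarrow> complex) set" where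
  "dual_space A = {f. (\<forall>x\<in>A. \<forall>y\<in>A. f (x + y) = f x + f y) \<and>
     (\<forall>c. \<forall>x\<in>A. f (c *\<^sub>C x) = c * f x) \<and>
     (\<exists>K. \<forall>x\<in>A. cmod (f x) \<le> K * norm x) \<and> (\<forall>x. x \<notin> A \<longrightarrow> f x = 0)}"

definition dual_norm :: "'a :: complex_normed_space set \<Rightarrow> ('a \<Rightarrow> complex) \<Rightarrow> real" where
  "dual_norm A f = (SUP x\<in>{x \<in> A. norm x \<le> 1}. cmod (f x))"

text \<open>A Banach space \<open>X\<close> with \<open>X* = A\<close> embeds canonically and isometrically into \<open>X** = A*\<close>.
  A predual of \<open>A\<close> is therefore a norm-closed subspace \<open>F\<close> of \<open>A*\<close> for which the evaluation map
  from \<open>A\<close> to \<open>F*\<close> is isometric (last but one conjunct) and onto (last conjunct).\<close>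

definition predual :: "'a :: complex_normed_space set \<Rightarrow> ('a \<Rightarrow> complex) set \<Rightarrow> bool" where
  "predual A F \<longleftrightarrow>
     F \<subseteq> dual_space A \<and>
     (\<lambda>x. 0) \<in> F \<and> (\<forall>f\<in>F. \<forall>g\<in>F. (\<lambda>x. f x + g x) \<in> F) \<and> (\<forall>c. \<forall>f\<in>F. (\<lambda>x. c * f x) \<in> F) \<and>
     (\<forall>g\<in>dual_space A. (\<forall>\<epsilon>>0. \<exists>f\<in>F. dual_norm A (\<lambda>x. g x - f x) < \<epsilon>) \<longrightarrow> g \<in> F) \<and>
     (\<forall>a\<in>A. norm a = (SUP f\<in>{f \<in> F. dual_norm A f \<le> 1}. cmod (f a))) \<and>
     (\<forall>\<psi> :: ('a \<Rightarrow> complex) \<Rightarrow> complex.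
        (\<forall>f\<in>F. \<forall>g\<in>F. \<psi> (\<lambda>x. f x + g x) = \<psi> f + \<psi> g) \<and>
        (\<forall>c. \<forall>f\<in>F. \<psi> (\<lambda>x. c * f x) = c * \<psi> f) \<and>
        (\<exists>K. \<forall>f\<in>F. cmod (\<psi> f) \<le> K * dual_norm A f) \<longrightarrow>
        (\<exists>a\<in>A. \<forall>f\<in>F. \<psi> f = f a))"

definition dual_banach_space :: "'a :: complex_normed_space set \<Rightarrow> bool" where
  "dual_banach_space A \<longleftrightarrow> csubspace A \<and> (\<exists>F. predual A F)"

text \<open>The topology \<open>\<sigma>(A, F)\<close> on \<open>A\<close>.\<close>

definition weak_star_topology :: "'a set \<Rightarrow> ('a \<Rightarrow> complex) set \<Rightarrow> 'a topology" where
  "weak_star_topology A F = topology_generated_by {{a \<in> A. f a \<in> U} | f U. f \<in> F \<and> open U}"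

section \<open>JW*-algebras\<close>

text \<open>A Jordan *-algebra is given by its carrier, product and involution; its linear structure and
  norm are those of the ambient type. The set \<open>B\<close> is a norm-closed self-adjoint Jordan subspace of a
  C*-algebra; the type of that C*-algebra is the first argument, because HOL cannot quantify over
  types. Jordan *-isomorphisms of JB*-algebras are automatically isometric; this is made explicit
  here since it is what ties the given norm of \<open>A\<close> to that of \<open>B\<close>.\<close>

definition JW_star_algebra ::
  "'c :: cstar_algebra itself \<Rightarrow> 'a :: complex_normed_space set \<Rightarrow> ('a \<Rightarrow> 'a \<Rightarrow> 'a) \<Rightarrow> ('a \<Rightarrow> 'a) \<Rightarrow> bool"
  where
  "JW_star_algebra T A jprod invo \<longleftrightarrow>
     csubspace A \<and> (\<forall>x\<in>A. \<forall>y\<in>A. jprod x y \<in> A) \<and> (\<forall>x\<in>A. invo x \<in> A) \<and>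
     (\<exists>(B :: 'c set) \<phi>.
        csubspace B \<and> closed B \<and> (\<forall>x\<in>B. star x \<in> B) \<and>
        (\<forall>x\<in>B. \<forall>y\<in>B. (1 / 2) *\<^sub>R (x * y + y * x) \<in> B) \<and>
        dual_banach_space B \<and>
        bij_betw \<phi> A B \<and>
        (\<forall>x\<in>A. \<forall>y\<in>A. \<phi> (x + y) = \<phi> x + \<phi> y) \<and> (\<forall>c. \<forall>x\<in>A. \<phi> (c *\<^sub>C x) = c *\<^sub>C \<phi> x) \<and>
        (\<forall>x\<in>A. norm (\<phi> x) = norm x) \<and>
        (\<forall>x\<in>A. \<forall>y\<in>A. \<phi> (jprod x y) = (1 / 2) *\<^sub>R (\<phi> x * \<phi> y + \<phi> y * \<phi> x)) \<and>
        (\<forall>x\<in>A. \<phi> (invo x) = star (\<phi> x)))"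

definition jordan_triple ::
  "('a \<Rightarrow> 'a \<Rightarrow> 'a) \<Rightarrow> ('a \<Rightarrow> 'a) \<Rightarrow> 'a \<Rightarrow> 'a \<Rightarrow> 'a \<Rightarrow> 'a :: complex_normed_space" where
  "jordan_triple jprod invo x y z =
     jprod (jprod x (invo y)) z + jprod (jprod (invo y) z) x - jprod (jprod z x) (invo y)"

definition tripotent :: "('a \<Rightarrow> 'a \<Rightarrow> 'a \<Rightarrow> 'a) \<Rightarrow> 'a \<Rightarrow> bool" where
  "tripotent tp u \<longleftrightarrow> tp u u u = u"

definition abelian_tripotent :: "'a set \<Rightarrow> ('a \<Rightarrow> 'a \<Rightarrow> 'a \<Rightarrow> 'a) \<Rightarrow> 'a \<Rightarrow> bool" where
  "abelian_tripotent A tp u \<longleftrightarrow> u \<in> A \<and> tripotent tp u \<and>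
     (let P = (\<lambda>x. tp u (tp u x u) u) ` A
      in \<forall>x\<in>P. \<forall>y\<in>P. \<forall>z\<in>P. tp (tp x u y) u z = tp x u (tp y u z))"

text \<open>As the triple product is symmetric in its outer arguments, the two inclusions below
  say \<open>{A,A,I} + {A,I,A} + {I,A,A} \<subseteq> I\<close>.\<close>

definition triple_ideal ::
  "'a :: complex_normed_space set \<Rightarrow> ('a \<Rightarrow> 'a \<Rightarrow> 'a \<Rightarrow> 'a) \<Rightarrow> 'a set \<Rightarrow> bool" where
  "triple_ideal A tp I \<longleftrightarrow> I \<subseteq> A \<and> csubspace I \<and>
     (\<forall>a\<in>A. \<forall>b\<in>A. \<forall>i\<in>I. tp a b i \<in> I \<and> tp a i b \<in> I)"

definition weak_star_closed_ideal_generated ::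
  "'a :: complex_normed_space set \<Rightarrow> ('a \<Rightarrow> complex) set \<Rightarrow> ('a \<Rightarrow> 'a \<Rightarrow> 'a \<Rightarrow> 'a) \<Rightarrow> 'a \<Rightarrow> 'a set" where
  "weak_star_closed_ideal_generated A F tp u =
     \<Inter> {I. triple_ideal A tp I \<and> closedin (weak_star_topology A F) I \<and> u \<in> I}"

text \<open>The predual of a JBW*-triple is unique, so the choice of \<open>F\<close> is immaterial.\<close>

definition type_I_JW_star_algebra ::
  "'c :: cstar_algebra itself \<Rightarrow> 'a :: complex_normed_space set \<Rightarrow> ('a \<Rightarrow> 'a \<Rightarrow> 'a) \<Rightarrow> ('a \<Rightarrow> 'a) \<Rightarrow> bool"
  where
  "type_I_JW_star_algebra T A jprod invo \<longleftrightarrow>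
     JW_star_algebra T A jprod invo \<and>
     (\<exists>F. predual A F \<and>
       (\<exists>u. abelian_tripotent A (jordan_triple jprod invo) u \<and>
         A = weak_star_closed_ideal_generated A F (jordan_triple jprod invo) u))"

end

theory Submission
  imports Defs
begin

text \<open>
  With \<open>q = e\<^sup>*e\<close>, the map \<open>x \<mapsto> e\<^sup>*x\<close> is an isometric Jordan *-isomorphism from the Peirce
  2-space of \<open>e\<close> onto the corner \<open>qMq\<close>, and the triple product derived from the Jordan structure
  is \<open>(xy\<^sup>*z + zy\<^sup>*x) / 2\<close>. The predual is the norm closure of the span of the vector functionals:
  a bounded functional on it restricts to a bounded sesquilinear form, hence is given by an
  operator, which lies in the space because the space is cut out by conditions that vector
  functionals detect.

  Below every nonzero projection of \<open>M\<close> there is a nonzero abelian one: its central support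
  majorizes some abelian \<open>p\<close>, and the range projection of any \<open>x = zyp \<noteq> 0\<close> is abelian. A maximal
  family of abelian projections below \<open>q\<close> with pairwise orthogonal central supports adds up to an
  abelian \<open>r \<le> q\<close> whose central support in the corner is \<open>q\<close>, and \<open>u = er\<close> is the required
  tripotent. Indeed a weak* closed Jordan ideal of \<open>qMq\<close> that contains \<open>r\<close> contains all \<open>yrw\<close>, and
  with them the range projections of all \<open>yr\<close>; a maximal orthogonal family of projections in the
  ideal therefore adds up to \<open>q\<close>, so the corresponding triple ideal contains \<open>e\<close>.
\<close>

section \<open>Hilbert space operators\<close>

text \<open>The hypothesis \<open>type_I\<close> is local: it offers some abelian projection below
  each nonzero central one. The conclusion is global, as a single tripotent has to generate the
  whole space, and exhaustion by maximal families bridges the two. Orthogonal central supports are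
  demanded in the first family because a sum of orthogonal abelian projections is abelian only if no
  element of \<open>M\<close> links two of them; this is written \<open>g * y * h = 0\<close> for
  all \<open>y\<close> in \<open>M\<close>. Range projections would usually come from the polar
  decomposition or from Borel functional calculus. Here they are strong limits of the polynomials
  \<open>range_approx x n\<close> in \<open>x * star x\<close>: a Jordan ideal is visibly stable
  under such polynomials, and the commutation relations that make a projection abelian survive
  strong limits. All approximants are bounded in norm (partial sums of orthogonal projections by 1,
  \<open>range_approx\<close> by 2), so a weak* closed ideal enters only through its closedness
  under bounded strongly convergent nets.\<close>

lemma star_zero [simp]: "star 0 = (0 :: 'a :: cstar_algebra)"
  using star_add[of "0 :: 'a" 0] by simp

lemma star_minus: "star (- x) = - star (x :: 'a :: cstar_algebra)"
  using star_add[of x "- x"] by (simp add: eq_neg_iff_add_eq_0 add.commute)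

lemma star_diff: "star (x - y) = star x - star (y :: 'a :: cstar_algebra)"
  using star_add[of x "- y"] by (simp add: star_minus)

lemma norm_star [simp]: "norm (star x) = norm (x :: 'a :: cstar_algebra)"
proof -
  have le: "norm y \<le> norm (star y)" for y :: 'a
  proof (cases "norm y = 0")
    case False
    have "norm y * norm y \<le> norm (star y) * norm y"
      using norm_star_mult[of y] norm_mult_ineq[of "star y" y] by (simp add: power2_eq_square)
    then show ?thesis using False by (simp add: mult_le_cancel_right)
  qed simp
  show ?thesis using le[of x] le[of "star x"] by (simp add: star_star)
qed

lemma projectionD:
  assumes "projection p"
  shows "star p = p" "p * p = p" "p * (p * x) = p * x"
  using assms by (simp_all add: projection_def mult.assoc[symmetric])

lemma norm_projection_le: "projection p \<Longrightarrow> norm p \<le> 1"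
  using norm_star_mult[of p] by (auto simp: projection_def power2_eq_square)

lemma csubspaceD:
  assumes "csubspace A"
  shows "0 \<in> A" "x \<in> A \<Longrightarrow> y \<in> A \<Longrightarrow> x + y \<in> A" "x \<in> A \<Longrightarrow> c *\<^sub>C x \<in> A"
    "x \<in> A \<Longrightarrow> r *\<^sub>R x \<in> A" "x \<in> A \<Longrightarrow> - x \<in> A" "x \<in> A \<Longrightarrow> y \<in> A \<Longrightarrow> x - y \<in> A"
proof -
  note * = assms[unfolded csubspace_def]
  show "0 \<in> A" "x \<in> A \<Longrightarrow> y \<in> A \<Longrightarrow> x + y \<in> A" "x \<in> A \<Longrightarrow> c *\<^sub>C x \<in> A" for x y
    using * by blast+
  show r: "x \<in> A \<Longrightarrow> r *\<^sub>R x \<in> A" for r x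
    using * by (simp add: scaleR_scaleC)
  show m: "x \<in> A \<Longrightarrow> - x \<in> A" for x
    using r[of x "-1"] by simp
  show "x \<in> A \<Longrightarrow> y \<in> A \<Longrightarrow> x - y \<in> A"
    using m[of y] * by (metis add_uminus_conv_diff)
qed

lemma cinner_add_right: "cinner u (v + w) = cinner u v + cinner u w"
  using cinner_commute[of u "v + w"] cinner_commute[of u v] cinner_commute[of u w]
  by (simp add: cinner_add_left)

lemma cinner_scaleC_right: "cinner u (c *\<^sub>C v) = cnj c * cinner u v"
  using cinner_commute[of u "c *\<^sub>C v"] cinner_commute[of u v]
  by (simp add: cinner_scaleC_left)

lemma inner_scaleC_right: "inner x (c *\<^sub>C y) = inner (cnj c *\<^sub>C x) y"
  for x y :: "'h :: complex_hilbert_space"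
  by (simp add: inner_eq_Re_cinner cinner_scaleC_left cinner_scaleC_right)

lemma cinner_zero_left [simp]: "cinner 0 y = 0"
  using cinner_add_left[of 0 0 y] by simp

lemma cinner_diff_left: "cinner (x - y) z = cinner x z - cinner y z"
  using cinner_add_left[of "x - y" y z] by simp

lemma norm_cinner_le: "cmod (cinner x y) \<le> norm x * norm y"
proof (cases "cinner x y = 0")
  case False
  \<comment> \<open>The phase \<open>u\<close> rotates the inner product onto the nonnegative real
    axis, where the real Cauchy-Schwarz inequality applies.\<close>
  define u where "u = cnj (cinner x y) / cmod (cinner x y)"
  have u: "cmod u = 1"
    using False by (simp add: u_def norm_divide)
  have "cinner (u *\<^sub>C x) y = cmod (cinner x y)"
    using False complex_norm_square[of "cinner x y"]
    by (simp add: cinner_scaleC_left u_def power2_eq_square field_simps)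
  then have "cmod (cinner x y) = inner (u *\<^sub>C x) y"
    by (simp add: inner_eq_Re_cinner)
  also have "\<dots> \<le> norm (u *\<^sub>C x) * norm y"
    by (rule norm_cauchy_schwarz)
  finally show ?thesis
    by (simp add: norm_scaleC u)
qed simp

lemma cinner_self: "cinner x x = complex_of_real ((norm x)\<^sup>2)"
  using cinner_commute[of x x] by (simp add: complex_eq_iff power2_norm_eq_inner inner_eq_Re_cinner)

lemma inner_left_eqI: "(\<And>z. inner x z = inner y z) \<Longrightarrow> x = y" for x y :: "'h :: real_inner"
  by (metis inner_eq_zero_iff inner_diff_left right_minus_eq)

lemma cinner_left_eqI: "(\<And>z. cinner x z = cinner y z) \<Longrightarrow> x = y"
  by (rule inner_left_eqI) (simp add: inner_eq_Re_cinner)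

lemmas bop_apply_add_right = linear_add[OF bounded_linear.linear[OF bounded_linear_bop_apply]]
lemmas bop_apply_diff_right = linear_diff[OF bounded_linear.linear[OF bounded_linear_bop_apply]]
lemmas bop_apply_scaleR_right = linear_scale[OF bounded_linear.linear[OF bounded_linear_bop_apply]]
lemmas bop_apply_zero_right [simp] = linear_0[OF bounded_linear.linear[OF bounded_linear_bop_apply]]
lemmas isCont_bop_apply = bounded_linear.isCont[OF bounded_linear_bop_apply continuous_ident]
lemmas tendsto_bop_apply = bounded_linear.tendsto[OF bounded_linear_bop_apply]

lemma inner_star: "inner (bop_apply T x) y = inner x (bop_apply (star T) y)"
  by (simp add: inner_eq_Re_cinner cinner_star)

lemma bop_apply_sum_left: "bop_apply (sum f S) x = (\<Sum>i\<in>S. bop_apply (f i) x)"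
  by (induction S rule: infinite_finite_induct) simp_all

section \<open>Operators from linear maps and from sesquilinear forms\<close>

lemma ex_bop:
  fixes f :: "'h :: complex_hilbert_space \<Rightarrow> 'h"
  assumes add: "\<And>x y. f (x + y) = f x + f y"
    and scale: "\<And>c x. f (c *\<^sub>C x) = c *\<^sub>C f x"
    and bound: "\<And>x. norm (f x) \<le> K * norm x"
  shows "\<exists>T. \<forall>x. bop_apply T x = f x"
proof -
  have "bounded_linear f"
    by (rule bounded_linear_intro[of _ K]) (simp_all add: add scaleR_scaleC scale bound mult.commute)
  then have "blinfun_apply (Blinfun f) = f"
    by (rule bounded_linear_Blinfun_apply)
  then have "bop_apply (bop_of_blinfun (Blinfun f)) = f"
    by (simp add: bop_apply.rep_eq bop_of_blinfun_inverse scale)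
  then show ?thesis
    by metis
qed

text \<open>The real Riesz lemma represents the real part of \<open>b x\<close>; replacing
  \<open>y\<close> by \<open>\<i> *\<^sub>C y\<close> then recovers the imaginary part. Later this
  turns a functional on the predual into an operator.\<close>

lemma ex_bop_sesquilinear:
  fixes b :: "'h :: complex_hilbert_space \<Rightarrow> 'h \<Rightarrow> complex"
  assumes add_left: "\<And>x y z. b (x + y) z = b x z + b y z"
    and scale_left: "\<And>c x z. b (c *\<^sub>C x) z = c * b x z"
    and add_right: "\<And>x y z. b z (x + y) = b z x + b z y"
    and scale_right: "\<And>c x z. b z (c *\<^sub>C x) = cnj c * b z x"
    and bound: "\<And>x y. cmod (b x y) \<le> K * norm x * norm y"
  obtains T where "\<And>x y. cinner (bop_apply T x) y = b x y"
proof -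
  have "\<exists>z. \<forall>y. Re (b x y) = inner z y" for x
  proof (rule hilbert_riesz, rule bounded_linear_intro)
    fix y y' :: 'h and r :: real
    show "Re (b x (y + y')) = Re (b x y) + Re (b x y')"
      by (simp add: add_right)
    show "Re (b x (r *\<^sub>R y)) = r *\<^sub>R Re (b x y)"
      by (simp add: scaleR_scaleC scale_right)
    show "norm (Re (b x y)) \<le> norm y * (K * norm x)"
      using bound[of x y] abs_Re_le_cmod[of "b x y"] by (simp add: mult_ac)
  qed
  then obtain f where f: "\<And>x y. Re (b x y) = inner (f x) y"
    by metis
  have b: "cinner (f x) y = b x y" for x y
  proof (rule complex_eqI)
    show "Re (cinner (f x) y) = Re (b x y)"
      by (simp add: f inner_eq_Re_cinner)
    have "Re (cinner (f x) (\<i> *\<^sub>C y)) = Re (b x (\<i> *\<^sub>C y))"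
      by (simp add: f inner_eq_Re_cinner)
    then show "Im (cinner (f x) y) = Im (b x y)"
      by (simp add: cinner_scaleC_right scale_right)
  qed
  have "\<exists>T. \<forall>x. bop_apply T x = f x"
  proof (rule ex_bop)
    show "f (x + y) = f x + f y" for x y
      by (rule cinner_left_eqI) (simp add: b add_left cinner_add_left)
    show "f (c *\<^sub>C x) = c *\<^sub>C f x" for c x
      by (rule cinner_left_eqI) (simp add: b scale_left cinner_scaleC_left)
    show "norm (f x) \<le> K * norm x" for x
    proof (cases "f x = 0")
      case True
      \<comment> \<open>The sign of \<open>K\<close> is not given; \<open>bound\<close> at
        \<open>(x, x)\<close> supplies it when \<open>x\<close> is nonzero.\<close>
      have "0 \<le> K * norm x * norm x"
        using bound[of x x] norm_ge_zero[of "b x x"] by linarith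
      then show ?thesis
        using True by (cases "x = 0") (simp_all add: zero_le_mult_iff)
    next
      case False
      have "norm (f x) * norm (f x) = cmod (cinner (f x) (f x))"
        by (simp add: cinner_self power2_eq_square norm_mult)
      also have "\<dots> \<le> K * norm x * norm (f x)"
        unfolding b by (rule bound)
      finally show ?thesis
        using False by (simp add: mult_le_cancel_right)
    qed
  qed
  then show thesis
    using that b by metis
qed

section \<open>Orthogonal complements and support projections\<close>

text \<open>A sequence in \<open>V\<close> minimizing the distance to \<open>h\<close> is Cauchy by
  the parallelogram law, because midpoints stay in \<open>V\<close>. At the minimizer
  \<open>v\<close> no direction in \<open>V\<close> can shorten the distance, which forces
  orthogonality.\<close>

lemma orthogonal_decomposition:
  fixes V :: "'h :: {real_inner, banach} set"
  assumes V: "subspace V" and closed: "closed V"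
  obtains v where "v \<in> V" "\<And>w. w \<in> V \<Longrightarrow> inner (h - v) w = 0"
proof -
  define d where "d = (INF v\<in>V. (norm (h - v))\<^sup>2)"
  have bdd: "bdd_below ((\<lambda>v. (norm (h - v))\<^sup>2) ` V)"
    by (rule bdd_belowI2[of _ 0]) simp
  have d_le: "d \<le> (norm (h - v))\<^sup>2" if "v \<in> V" for v
    unfolding d_def by (rule cINF_lower[OF bdd that])
  have "\<exists>v\<in>V. (norm (h - v))\<^sup>2 < d + 1 / real (Suc n)" for n
  proof -
    have "(INF v\<in>V. (norm (h - v))\<^sup>2) < d + 1 / real (Suc n)"
      by (simp add: d_def[symmetric])
    moreover have "V \<noteq> {}"
      using subspace_0[OF V] by blast
    ultimately show ?thesis
      using cINF_less_iff[OF _ bdd] by auto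
  qed
  then obtain X where X: "\<And>n. X n \<in> V" "\<And>n. (norm (h - X n))\<^sup>2 < d + 1 / real (Suc n)"
    by metis
  have par: "(norm (x - y))\<^sup>2 =
      2 * (norm (h - x))\<^sup>2 + 2 * (norm (h - y))\<^sup>2 - 4 * (norm (h - (1 / 2) *\<^sub>R (x + y)))\<^sup>2" for x y
    by (simp add: power2_norm_eq_inner inner_diff inner_add inner_commute algebra_simps)
  have near: "(norm (X i - X j))\<^sup>2 \<le> 2 / real (Suc i) + 2 / real (Suc j)" for i j
  proof -
    have "(1 / 2) *\<^sub>R (X i + X j) \<in> V"
      by (intro subspace_scale subspace_add V X)
    from d_le[OF this] show ?thesis
      using par[of "X i" "X j"] X(2)[of i] X(2)[of j] by simp
  qed
  have "Cauchy X"
  proof (rule metric_CauchyI)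
    fix e :: real assume e: "0 < e"
    obtain N where N: "4 / e\<^sup>2 < real (Suc N)"
      by (meson less_Suc_eq of_nat_less_iff order.strict_trans reals_Archimedean2 lessI)
    have "dist (X i) (X j) < e" if "N \<le> i" "N \<le> j" for i j
    proof -
      have "2 / real (Suc i) \<le> 2 / real (Suc N)" "2 / real (Suc j) \<le> 2 / real (Suc N)"
        using that by (simp_all add: frac_le)
      then have "(norm (X i - X j))\<^sup>2 \<le> 4 / real (Suc N)"
        using near[of i j] by simp
      also have "\<dots> < e\<^sup>2"
        using N e by (simp add: field_simps)
      finally show ?thesis
        using e by (simp add: dist_norm power2_less_imp_less)
    qed
    then show "\<exists>N. \<forall>i\<ge>N. \<forall>j\<ge>N. dist (X i) (X j) < e" by blast
  qed
  then obtain v where v: "X \<longlonglongrightarrow> v"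
    by (meson Cauchy_convergent_iff convergent_def)
  have vV: "v \<in> V"
    using closed_sequentially[OF closed _ v] X(1) by blast
  have "(\<lambda>n. (norm (h - X n))\<^sup>2) \<longlonglongrightarrow> (norm (h - v))\<^sup>2"
    by (intro tendsto_intros v)
  moreover have "(\<lambda>n. d + 1 / real (Suc n)) \<longlonglongrightarrow> d + 0"
    using LIMSEQ_inverse_real_of_nat by (intro tendsto_intros) (simp add: inverse_eq_divide)
  ultimately have v_le: "(norm (h - v))\<^sup>2 \<le> d + 0"
    by (rule LIMSEQ_le) (use X(2) less_imp_le in blast)
  have "inner (h - v) w = 0" if w: "w \<in> V" for w
  proof (cases "w = 0")
    case False
    \<comment> \<open>This \<open>t\<close> minimizes the quadratic polynomial giving the squared
      norm of \<open>h - v - t *\<^sub>R w\<close>.\<close>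
    define c t where "c = inner (h - v) w" and "t = c / (norm w)\<^sup>2"
    have "v + t *\<^sub>R w \<in> V"
      by (intro subspace_scale subspace_add V vV w)
    from d_le[OF this] have "(norm (h - v))\<^sup>2 \<le> (norm (h - v - t *\<^sub>R w))\<^sup>2"
      using v_le unfolding diff_diff_eq by linarith
    also have "\<dots> = (norm (h - v))\<^sup>2 - 2 * t * c + t\<^sup>2 * (norm w)\<^sup>2"
      unfolding c_def power2_norm_eq_inner
      by (simp add: inner_diff inner_commute power2_eq_square algebra_simps)
    also have "t\<^sup>2 * (norm w)\<^sup>2 = t * c"
      using False by (simp add: t_def power2_eq_square)
    finally have "t * c \<le> 0"
      by linarith
    then have "t * c * (norm w)\<^sup>2 \<le> 0"
      by (simp add: mult_nonpos_nonneg)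
    then have "c\<^sup>2 \<le> 0"
      using False by (simp add: t_def power2_eq_square)
    then show ?thesis
      by (simp add: c_def)
  qed simp
  then show thesis
    using that vV by blast
qed

text \<open>\<open>R\<close> is the projection onto the orthogonal complement of the common kernel of \<open>S\<close>, that is,
  the supremum of the right supports of the operators in \<open>S\<close>.\<close>

definition join_support :: "'h :: complex_hilbert_space bop set \<Rightarrow> 'h bop \<Rightarrow> bool" where
  "join_support S R \<longleftrightarrow> projection R \<and> (\<forall>b\<in>S. b * R = b) \<and>
     (\<forall>v. (\<forall>b\<in>S. bop_apply b v = 0) \<longrightarrow> bop_apply R v = 0)"

text \<open>\<open>R\<close> is the complement of the orthogonal projection \<open>P\<close> onto
  the common kernel \<open>V\<close>. Additivity and complex homogeneity of \<open>P\<close> follow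
  from uniqueness of the decomposition, since \<open>V\<close> is stable under complex scalars.
  Self-adjointness is checked for the real inner product at \<open>y\<close> and at
  \<open>\<i> *\<^sub>C y\<close>.\<close>

lemma ex_join_support:
  fixes S :: "'h :: complex_hilbert_space bop set"
  obtains R where "join_support S R"
proof -
  define V where "V = {v. \<forall>b\<in>S. bop_apply b v = 0}"
  have sub: "subspace V"
    unfolding subspace_def V_def by (simp add: bop_apply_add_right bop_apply_scaleR_right)
  have scaleV: "c *\<^sub>C v \<in> V" if "v \<in> V" for c v
    using that by (simp add: V_def bop_apply_scaleC)
  have "V = (\<Inter>b\<in>S. bop_apply b -` {0})"
    by (auto simp: V_def)
  moreover have "closed (bop_apply b -` {0})" for b :: "'h bop"
    by (intro continuous_closed_vimage closed_singleton) (simp add: isCont_bop_apply)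
  ultimately have closed: "closed V"
    by (simp add: closed_INT)
  have "\<exists>v\<in>V. \<forall>w\<in>V. inner (h - v) w = 0" for h
    using orthogonal_decomposition[OF sub closed] by metis
  then obtain P where P: "\<And>h. P h \<in> V" "\<And>h w. w \<in> V \<Longrightarrow> inner (h - P h) w = 0"
    by metis
  have uniq: "P h = v" if "v \<in> V" "\<And>w. w \<in> V \<Longrightarrow> inner (h - v) w = 0" for h v
  proof -
    have "P h - v \<in> V"
      by (intro subspace_diff sub P that)
    from that(2)[OF this] P(2)[OF this, of h] have "inner (P h - v) (P h - v) = 0"
      by (simp add: inner_diff)
    then show ?thesis by simp
  qed
  have pyth: "(norm h)\<^sup>2 = (norm (P h))\<^sup>2 + (norm (h - P h))\<^sup>2" for h
    using P(2)[OF P(1), of h h] by (simp add: power2_norm_eq_inner inner_diff inner_commute)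
  have "\<exists>R. \<forall>x. bop_apply R x = x - P x"
  proof (rule ex_bop)
    have "P (x + y) = P x + P y" for x y
    proof (rule uniq)
      show "P x + P y \<in> V" by (intro subspace_add sub P)
      fix w assume w: "w \<in> V"
      show "inner (x + y - (P x + P y)) w = 0"
        using P(2)[OF w, of x] P(2)[OF w, of y] by (simp add: inner_diff_left inner_add_left)
    qed
    then show "x + y - P (x + y) = x - P x + (y - P y)" for x y
      by simp
    have diff: "c *\<^sub>C (x - P x) = c *\<^sub>C x - c *\<^sub>C P x" for c x
      by (rule linear_diff[OF bounded_linear.linear[OF bounded_linear_scaleC]])
    have "P (c *\<^sub>C x) = c *\<^sub>C P x" for c x
    proof (rule uniq)
      show "c *\<^sub>C P x \<in> V" by (intro scaleV P)
      fix w assume w: "w \<in> V"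
      show "inner (c *\<^sub>C x - c *\<^sub>C P x) w = 0"
        using P(2)[OF scaleV[OF w, of "cnj c"], of x] by (simp add: inner_scaleC_right diff)
    qed
    then show "c *\<^sub>C x - P (c *\<^sub>C x) = c *\<^sub>C (x - P x)" for c x
      by (simp add: diff)
    have "(norm (x - P x))\<^sup>2 \<le> (norm x)\<^sup>2" for x
      using pyth[of x] by simp
    then show "norm (x - P x) \<le> 1 * norm x" for x
      using power2_le_imp_le[OF _ norm_ge_zero] by (metis mult_1)
  qed
  then obtain R where R: "\<And>x. bop_apply R x = x - P x"
    by blast
  have PV: "P v = v" if "v \<in> V" for v
    by (rule uniq) (simp_all add: that)
  have kill: "bop_apply b (P x) = 0" if "b \<in> S" for b x
    using P(1)[of x] that by (simp add: V_def)
  have Psym: "inner (P x) y = inner (P x) (P y)" for x y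
    using P(2)[OF P(1)[of x], of y] by (simp add: inner_diff_right inner_diff_left inner_commute)
  have "star R = R"
  proof (rule star_bopI)
    have sym: "inner (bop_apply R x) y = inner x (bop_apply R y)" for x y
      using Psym[of x y] Psym[of y x] by (simp add: R inner_diff_left inner_diff_right inner_commute)
    show "cinner (bop_apply R x) y = cinner x (bop_apply R y)" for x y
      using sym[of x y] sym[of x "\<i> *\<^sub>C y"] by (simp add: cinner_eq bop_apply_scaleC)
  qed
  moreover have "R * R = R"
  proof (rule bop_eqI)
    fix x
    have "P (x - P x) = 0"
      by (rule uniq) (simp_all add: P subspace_0[OF sub])
    then show "bop_apply (R * R) x = bop_apply R x"
      by (simp add: R)
  qed
  moreover have "b * R = b" if "b \<in> S" for b
    by (rule bop_eqI) (simp add: R bop_apply_diff_right kill[OF that])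
  ultimately have "join_support S R"
    unfolding join_support_def projection_def using R PV by (simp add: V_def)
  then show thesis
    by (rule that)
qed

text \<open>An operator that preserves the common kernel satisfies \<open>R * z = R * z * R\<close>.
  Applying this to \<open>y\<close>, and to \<open>star y\<close> followed by taking adjoints,
  identifies both \<open>R * y\<close> and \<open>y * R\<close> with
  \<open>R * y * R\<close>.\<close>

lemma join_support_commute:
  assumes R: "join_support S R"
    and y: "\<And>v b. (\<And>c. c \<in> S \<Longrightarrow> bop_apply c v = 0) \<Longrightarrow> b \<in> S \<Longrightarrow> bop_apply b (bop_apply y v) = 0"
    and ys: "\<And>v b. (\<And>c. c \<in> S \<Longrightarrow> bop_apply c v = 0) \<Longrightarrow> b \<in> S \<Longrightarrow> bop_apply b (bop_apply (star y) v) = 0"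
  shows "R * y = y * R"
proof -
  have *: "R * z = R * z * R"
    if z: "\<And>v b. (\<And>c. c \<in> S \<Longrightarrow> bop_apply c v = 0) \<Longrightarrow> b \<in> S \<Longrightarrow> bop_apply b (bop_apply z v) = 0" for z
  proof (rule bop_eqI)
    fix v
    have "bop_apply b (v - bop_apply R v) = 0" if "b \<in> S" for b
    proof -
      have "bop_apply b (bop_apply R v) = bop_apply b v"
        using R that by (metis bop_apply_mult join_support_def)
      then show ?thesis by (simp add: bop_apply_diff_right)
    qed
    then have "bop_apply R (bop_apply z (v - bop_apply R v)) = 0"
      using R z unfolding join_support_def by blast
    then show "bop_apply (R * z) v = bop_apply (R * z * R) v"
      by (simp add: bop_apply_diff_right)
  qed
  have sR: "star R = R"
    using R by (simp add: join_support_def projection_def)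
  have "R * star y = R * star y * R"
    by (rule *) (rule ys)
  then have "star (R * star y) = star (R * star y * R)"
    by simp
  then have "y * R = R * y * R"
    by (simp add: star_mult star_star sR mult.assoc)
  then show ?thesis
    using *[of y] y by metis
qed

section \<open>Supports of subsets of a von Neumann algebra\<close>

lemma von_neumann_algebraD:
  assumes "von_neumann_algebra M"
  shows "csubspace M" "x \<in> M \<Longrightarrow> y \<in> M \<Longrightarrow> x * y \<in> M" "x \<in> M \<Longrightarrow> star x \<in> M"
    "commutant (commutant M) = M"
  using assms by (auto simp: von_neumann_algebra_def)

lemma commutant_star:
  assumes "\<And>x. x \<in> M \<Longrightarrow> star x \<in> M" "y \<in> commutant M"
  shows "star y \<in> commutant M"
  unfolding commutant_def
proof (clarify)
  fix x assume "x \<in> M"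
  then have "star x * y = y * star x"
    using assms by (simp add: commutant_def)
  then have "star (star x * y) = star (y * star x)"
    by simp
  then show "x * star y = star y * x"
    by (simp add: star_mult star_star)
qed

text \<open>Elements of the commutant preserve the common kernel of \<open>S\<close>, so they
  commute with \<open>R\<close>; the bicommutant property does the rest.\<close>

lemma join_support_in:
  assumes M: "von_neumann_algebra M" and S: "S \<subseteq> M" and R: "join_support S R"
  shows "R \<in> M"
proof -
  have kill: "bop_apply b (bop_apply y v) = 0"
    if "y \<in> commutant M" "\<And>c. c \<in> S \<Longrightarrow> bop_apply c v = 0" "b \<in> S" for b y v
  proof -
    have "b * y = y * b"
      using that S by (auto simp: commutant_def)
    then show ?thesis
      using that by (metis bop_apply_mult bop_apply_zero_right)
  qed
  have "R * y = y * R" if "y \<in> commutant M" for y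
    using kill[OF that] kill[OF commutant_star[OF von_neumann_algebraD(3)[OF M] that]]
    by (intro join_support_commute[OF R]) blast+
  then have "R \<in> commutant (commutant M)"
    by (auto simp: commutant_def)
  then show ?thesis
    using M by (simp add: von_neumann_algebraD)
qed

section \<open>Limits of operators\<close>

text \<open>This is \<open>1 - (1 - xx\<^sup>*)\<^sup>n\<close>, written without an identity element so that it visibly stays in
  every ideal containing \<open>xx\<^sup>*\<close>.\<close>

primrec range_approx :: "'a :: cstar_algebra \<Rightarrow> nat \<Rightarrow> 'a" where
  "range_approx x 0 = 0"
| "range_approx x (Suc n) = range_approx x n + x * star x - x * star x * range_approx x n"

text \<open>The operator \<open>T\<close>, which is the identity minus \<open>x * star x\<close>, is
  self-adjoint with \<open>T\<^sup>2 \<le> T \<le> 1\<close>, because \<open>x\<close> is a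
  contraction. Its powers therefore converge strongly to vectors fixed by \<open>T\<close>, that is,
  killed by \<open>star x\<close> and hence by \<open>R\<close>. The bound 2 is the triangle
  inequality for the identity minus a power of \<open>T\<close>.\<close>

lemma range_approx:
  fixes x :: "'h :: complex_hilbert_space bop"
  assumes x: "norm x \<le> 1" and R: "join_support {star x} R"
  shows norm_range_approx: "norm (range_approx x n) \<le> 2"
    and tendsto_range_approx: "(\<lambda>n. bop_apply (range_approx x n) v) \<longlonglongrightarrow> bop_apply R v"
proof -
  define T where "T v = v - bop_apply x (bop_apply (star x) v)" for v
  have iter: "(T ^^ n) v = v - bop_apply (range_approx x n) v" for n v
  proof (induction n)
    case (Suc n)
    then have "(T ^^ Suc n) v = T (v - bop_apply (range_approx x n) v)"
      by simp
    also have "\<dots> = v - bop_apply (range_approx x (Suc n)) v"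
      by (simp add: T_def bop_apply_diff_right)
    finally show ?case .
  qed simp
  have le: "norm (bop_apply y v) \<le> norm v" if "norm y \<le> 1" for y :: "'h bop" and v
    using norm_bop_apply[of y v] mult_right_mono[OF that norm_ge_zero[of v]] by simp
  have sym: "inner (T u) v = inner u (T v)" for u v
    by (simp add: T_def inner_diff inner_star star_star)
  have inner_T: "inner (T w) w = (norm w)\<^sup>2 - (norm (bop_apply (star x) w))\<^sup>2" for w
    by (simp add: T_def inner_diff inner_star power2_norm_eq_inner)
  have norm_T: "(norm (T w))\<^sup>2 \<le> inner (T w) w" for w
  proof -
    have "(norm (T w))\<^sup>2 = (norm w)\<^sup>2 - 2 * (norm (bop_apply (star x) w))\<^sup>2
        + (norm (bop_apply x (bop_apply (star x) w)))\<^sup>2"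
      using inner_star[of x "bop_apply (star x) w" w]
      by (simp add: T_def power2_norm_eq_inner inner_diff inner_commute)
    moreover have "(norm (bop_apply x (bop_apply (star x) w)))\<^sup>2 \<le> (norm (bop_apply (star x) w))\<^sup>2"
      by (intro power_mono le x norm_ge_zero)
    ultimately show ?thesis
      unfolding inner_T by linarith
  qed
  have contr: "norm (T w) \<le> norm w" for w
  proof (rule power2_le_imp_le)
    show "(norm (T w))\<^sup>2 \<le> (norm w)\<^sup>2"
      using norm_T[of w] zero_le_power2[of "norm (bop_apply (star x) w)"] unfolding inner_T by linarith
  qed simp
  have contr_iter: "norm ((T ^^ n) w) \<le> norm w" for n w
    by (induction n) (simp_all add: order_trans[OF contr])
  show "norm (range_approx x n) \<le> 2"
  proof (rule norm_bop_bound)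
    fix v
    have "bop_apply (range_approx x n) v = v - (T ^^ n) v"
      by (simp add: iter)
    then show "norm (bop_apply (range_approx x n) v) \<le> 2 * norm v"
      using norm_triangle_ineq4[of v "(T ^^ n) v"] contr_iter[of n v] by simp
  qed simp
  \<comment> \<open>As \<open>\<langle>T\<^sup>n v, v\<rangle>\<close> decreases and is nonnegative, it converges, which makes \<open>T\<^sup>n v\<close> Cauchy.\<close>
  have conv: "convergent (\<lambda>n. (T ^^ n) v)" for v
  proof -
    define t where "t n = inner ((T ^^ n) v) v" for n
    have sym_iter: "inner ((T ^^ n) u) w = inner u ((T ^^ n) w)" for n u w
      by (induction n arbitrary: u w) (simp_all add: sym funpow_swap1)
    have t_add: "inner ((T ^^ m) v) ((T ^^ n) v) = t (n + m)" for m n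
      by (simp add: t_def sym_iter[of n, symmetric] funpow_add)
    have t_even: "t (m + m) = (norm ((T ^^ m) v))\<^sup>2" for m
      using t_add[of m m] by (simp add: power2_norm_eq_inner)
    have t_odd: "t (Suc (m + m)) = inner (T ((T ^^ m) v)) ((T ^^ m) v)" for m
      using t_add[of "Suc m" m] by simp
    \<comment> \<open>The parity of \<open>n\<close> decides which inequality is used: after an even
      index it is \<open>T \<le> 1\<close> at the vector \<open>(T ^^ m) v\<close>, after an odd one
      it is \<open>norm_T\<close> at the same vector.\<close>
    have step: "t (Suc n) \<le> t n \<and> 0 \<le> t n" for n
    proof -
      have even: "t (Suc (m + m)) \<le> t (m + m)" for m
        unfolding t_odd t_even inner_T by simp
      have odd: "t (Suc (Suc (m + m))) \<le> t (Suc (m + m))" for m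
        using norm_T[of "(T ^^ m) v"] t_even[of "Suc m"] unfolding t_odd by simp
      have nn: "0 \<le> t (m + m)" for m
        unfolding t_even by simp
      obtain m where "n = m + m \<or> n = Suc (m + m)"
        by (metis evenE oddE mult_2 Suc_eq_plus1)
      then show ?thesis
        using even[of m] odd[of m] nn[of m] nn[of "Suc m"] by auto
    qed
    then have "decseq t" "\<And>n. 0 \<le> t n"
      by (auto intro: decseq_SucI)
    then obtain L where L: "t \<longlonglongrightarrow> L"
      by (metis decseq_convergent)
    have "Cauchy (\<lambda>n. (T ^^ n) v)"
    proof (rule metric_CauchyI)
      fix e :: real assume e: "0 < e"
      \<comment> \<open>The squared distance below is a combination of values of \<open>t\<close>
        with weights 1, -2 and 1, so four errors of size \<open>e\<^sup>2 / 4\<close> are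
        allowed.\<close>
      obtain N where N: "\<And>n. N \<le> n \<Longrightarrow> \<bar>t n - L\<bar> < e\<^sup>2 / 4"
        using LIMSEQ_D[OF L, of "e\<^sup>2 / 4"] e by auto
      have "dist ((T ^^ m) v) ((T ^^ n) v) < e" if "N \<le> m" "N \<le> n" for m n
      proof -
        have "(dist ((T ^^ m) v) ((T ^^ n) v))\<^sup>2 = t (m + m) - 2 * t (n + m) + t (n + n)"
          unfolding dist_norm power2_norm_eq_inner
          by (simp add: inner_diff t_add add.commute)
        also have "\<dots> < e\<^sup>2"
          using N[of "m + m"] N[of "n + m"] N[of "n + n"] that unfolding abs_less_iff
          by (simp add: field_simps)
        finally show ?thesis
          using e by (simp add: power2_less_imp_less)
      qed
      then show "\<exists>N. \<forall>m\<ge>N. \<forall>n\<ge>N. dist ((T ^^ m) v) ((T ^^ n) v) < e"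
        by blast
    qed
    then show ?thesis
      by (rule Cauchy_convergent)
  qed
  have Rp: "projection R" and xR: "star x * R = star x"
    and kill: "\<And>v. bop_apply (star x) v = 0 \<Longrightarrow> bop_apply R v = 0"
    using R by (auto simp: join_support_def)
  have Rx: "R * x = x"
    using arg_cong[OF xR, of star] Rp by (simp add: star_mult star_star projection_def)
  have TR: "bop_apply R (T u) = T (bop_apply R u)" for u
  proof -
    have "bop_apply R (bop_apply x w) = bop_apply x w"
      "bop_apply (star x) (bop_apply R w) = bop_apply (star x) w" for w
      by (metis Rx bop_apply_mult) (metis xR bop_apply_mult)
    then show ?thesis
      by (simp add: T_def bop_apply_diff_right)
  qed
  have TR_iter: "bop_apply R ((T ^^ n) u) = (T ^^ n) (bop_apply R u)" for n u
    by (induction n) (simp_all add: TR)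
  have RR: "bop_apply R (bop_apply R u) = bop_apply R u" for u
    using Rp by (metis bop_apply_mult projection_def)
  \<comment> \<open>The iteration starts at \<open>R v\<close>: as \<open>T\<close> commutes with
    \<open>R\<close>, the limit stays in the range of \<open>R\<close>, while being fixed by
    \<open>T\<close> puts it in the kernel of \<open>R\<close>. Hence it is 0.\<close>
  obtain w where w: "(\<lambda>n. (T ^^ n) (bop_apply R v)) \<longlonglongrightarrow> w"
    using conv unfolding convergent_def by blast
  have "(\<lambda>n. T ((T ^^ n) (bop_apply R v))) \<longlonglongrightarrow> T w"
    unfolding T_def by (intro tendsto_intros tendsto_bop_apply w[unfolded T_def])
  moreover have "(\<lambda>n. T ((T ^^ n) (bop_apply R v))) \<longlonglongrightarrow> w"
    using LIMSEQ_Suc[OF w] by simp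
  ultimately have "T w = w"
    by (rule LIMSEQ_unique)
  then have "norm (bop_apply (star x) w) = 0"
    using inner_T[of w] by (simp add: power2_norm_eq_inner)
  then have "bop_apply R w = 0"
    using kill by simp
  moreover have "bop_apply R w = w"
    using tendsto_bop_apply[OF w, of R] w by (simp add: TR_iter RR LIMSEQ_unique)
  ultimately have w0: "w = 0"
    by simp
  have "bop_apply (range_approx x n) (bop_apply R v) = bop_apply (range_approx x n) v" for n
  proof -
    have "range_approx x n * R = range_approx x n"
      by (induction n) (simp_all add: algebra_simps xR)
    then show ?thesis
      by (metis bop_apply_mult)
  qed
  then have "bop_apply (range_approx x n) v = bop_apply R v - (T ^^ n) (bop_apply R v)" for n
    by (simp add: iter)
  then show "(\<lambda>n. bop_apply (range_approx x n) v) \<longlonglongrightarrow> bop_apply R v"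
    using tendsto_diff[OF tendsto_const w, of "bop_apply R v"] by (simp add: w0)
qed

section \<open>Sums of orthogonal projections\<close>

definition orthogonal_projections :: "'a :: cstar_algebra set \<Rightarrow> bool" where
  "orthogonal_projections G \<longleftrightarrow>
     (\<forall>g\<in>G. projection g) \<and> (\<forall>g\<in>G. \<forall>h\<in>G. g \<noteq> h \<longrightarrow> g * h = 0)"

lemma projection_sum:
  assumes "finite F" "orthogonal_projections F"
  shows "projection (\<Sum>F)"
  using assms
proof (induction F)
  case (insert g F)
  then have "projection (\<Sum>F)" "projection g"
    by (auto simp: orthogonal_projections_def)
  moreover have "g * \<Sum>F = 0" "\<Sum>F * g = 0"
    using insert by (auto simp: orthogonal_projections_def sum_distrib_left sum_distrib_right
        intro!: sum.neutral)
  ultimately show ?case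
    using insert by (simp add: projection_def star_add algebra_simps)
qed (simp add: projection_def)

text \<open>By orthogonality the squared norms of the pieces \<open>g v\<close> sum to at most that
  of \<open>v\<close>, so the finite partial sums are Cauchy. Their limit \<open>w\<close> satisfies
  \<open>g w = g v\<close> for every \<open>g\<close>, whence \<open>R w = R v\<close>; and
  \<open>R\<close> fixes all partial sums, hence \<open>w\<close>.\<close>

lemma tendsto_sum_projections:
  fixes G :: "'h :: complex_hilbert_space bop set"
  assumes G: "orthogonal_projections G" and R: "join_support G R"
  shows "((\<lambda>F. bop_apply (\<Sum>F) v) \<longlongrightarrow> bop_apply R v) (finite_subsets_at_top G)"
proof -
  define s where "s F = (\<Sum>g\<in>F. (norm (bop_apply g v))\<^sup>2)" for F
  have s: "(norm (bop_apply (\<Sum>F) v))\<^sup>2 = s F" if "finite F" "F \<subseteq> G" for F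
  proof -
    have "pairwise (\<lambda>g h. orthogonal (bop_apply g v) (bop_apply h v)) F"
    proof (rule pairwiseI)
      fix g h assume "g \<in> F" "h \<in> F" "g \<noteq> h"
      then have "star g = g" "g * h = 0"
        using G that by (auto simp: orthogonal_projections_def projection_def)
      then show "orthogonal (bop_apply g v) (bop_apply h v)"
        by (metis orthogonal_def inner_star bop_apply_mult bop_apply_zero inner_zero_right)
    qed
    from norm_sum_Pythagorean[OF \<open>finite F\<close> this] show ?thesis
      by (simp add: s_def bop_apply_sum_left)
  qed
  have s_le: "s F \<le> (norm v)\<^sup>2" if "finite F" "F \<subseteq> G" for F
  proof -
    have "orthogonal_projections F"
      using G that by (auto simp: orthogonal_projections_def)
    then have "norm (\<Sum>F) \<le> 1"
      using projection_sum norm_projection_le that by blast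
    then have "norm (bop_apply (\<Sum>F) v) \<le> norm v"
      using norm_bop_apply[of "\<Sum>F" v] mult_right_mono[OF _ norm_ge_zero[of v], of "norm (\<Sum>F)" 1] by simp
    then show ?thesis
      unfolding s[OF that, symmetric] by (simp add: power_mono)
  qed
  have "(\<lambda>g. (norm (bop_apply g v))\<^sup>2) summable_on G"
    by (rule nonneg_bdd_above_summable_on) (use s_le in \<open>auto simp: s_def intro!: bdd_aboveI\<close>)
  then obtain L where L: "(s \<longlongrightarrow> L) (finite_subsets_at_top G)"
    unfolding summable_on_def has_sum_def s_def by blast
  have "\<exists>P. eventually P (finite_subsets_at_top G) \<and>
      (\<forall>F F'. P F \<and> P F' \<longrightarrow> dist (bop_apply (\<Sum>F) v) (bop_apply (\<Sum>F') v) < e)" if e: "0 < e" for e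
  proof -
    \<comment> \<open>Two errors of \<open>e\<^sup>2 / 8\<close> bound a squared distance to the sum
      over \<open>F0\<close> by the square of \<open>e / 2\<close>.\<close>
    have "eventually (\<lambda>F. dist (s F) L < e\<^sup>2 / 8) (finite_subsets_at_top G)"
      using tendstoD[OF L, of "e\<^sup>2 / 8"] e by simp
    then obtain F0 where F0: "finite F0" "F0 \<subseteq> G"
      and near: "\<And>F. finite F \<Longrightarrow> F0 \<subseteq> F \<Longrightarrow> F \<subseteq> G \<Longrightarrow> dist (s F) L < e\<^sup>2 / 8"
      unfolding eventually_finite_subsets_at_top by metis
    define P where "P F \<longleftrightarrow> finite F \<and> F0 \<subseteq> F \<and> F \<subseteq> G" for F
    have "eventually P (finite_subsets_at_top G)"
      unfolding eventually_finite_subsets_at_top P_def using F0 by blast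
    moreover have dist0: "dist (bop_apply (\<Sum>F) v) (bop_apply (\<Sum>F0) v) < e / 2" if "P F" for F
    proof -
      have F: "finite F" "F0 \<subseteq> F" "F \<subseteq> G"
        using that by (auto simp: P_def)
      have "(dist (bop_apply (\<Sum>F) v) (bop_apply (\<Sum>F0) v))\<^sup>2 = (norm (bop_apply (\<Sum>(F - F0)) v))\<^sup>2"
        using F by (simp add: dist_norm sum_diff)
      also have "\<dots> = s (F - F0)"
        using F by (intro s) auto
      also have "\<dots> = s F - s F0"
        using F by (simp add: s_def sum_diff)
      also have "\<dots> < (e / 2)\<^sup>2"
        using near[OF F] near[OF F0(1) order_refl F0(2)]
        unfolding dist_real_def abs_less_iff power_divide by simp
      finally show ?thesis
        by (rule power2_less_imp_less) (use e in simp)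
    qed
    moreover have "dist (bop_apply (\<Sum>F) v) (bop_apply (\<Sum>F') v) < e" if "P F" "P F'" for F F'
      using dist_triangle2[of "bop_apply (\<Sum>F) v" "bop_apply (\<Sum>F') v" "bop_apply (\<Sum>F0) v"]
        dist0[OF that(1)] dist0[OF that(2)] by simp
    ultimately show ?thesis
      by blast
  qed
  \<comment> \<open>\<open>G\<close> may be uncountable, so completeness is used for filters and not
    for sequences.\<close>
  then have "cauchy_filter (filtermap (\<lambda>F. bop_apply (\<Sum>F) v) (finite_subsets_at_top G))"
    by (simp add: cauchy_filter_metric_filtermap)
  moreover have "complete (UNIV :: 'h set)"
    by (meson Cauchy_convergent UNIV_I complete_def convergent_def)
  ultimately obtain w where w: "((\<lambda>F. bop_apply (\<Sum>F) v) \<longlongrightarrow> w) (finite_subsets_at_top G)"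
    using complete_uniform[where S=UNIV] by (force simp add: filterlim_def)
  have Rg: "R * g = g" "g * R = g" if "g \<in> G" for g
  proof -
    show "g * R = g"
      using R that by (simp add: join_support_def)
    from arg_cong[OF this, of star] show "R * g = g"
      using R G that by (simp add: join_support_def orthogonal_projections_def projection_def star_mult)
  qed
  have "bop_apply g w = bop_apply g v" if g: "g \<in> G" for g
  proof (rule tendsto_unique)
    show "((\<lambda>F. bop_apply g (bop_apply (\<Sum>F) v)) \<longlongrightarrow> bop_apply g w) (finite_subsets_at_top G)"
      by (rule tendsto_bop_apply[OF w])
    have "bop_apply g (bop_apply (\<Sum>F) v) = bop_apply g v" if F: "finite F" "{g} \<subseteq> F" "F \<subseteq> G" for F
    proof -
      have "g * \<Sum>F = (\<Sum>h\<in>F. if h = g then g else 0)"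
        unfolding sum_distrib_left
        using F g G by (intro sum.cong) (auto simp: orthogonal_projections_def projection_def)
      also have "\<dots> = g"
        using F by simp
      finally show ?thesis
        by (metis bop_apply_mult)
    qed
    then have "eventually (\<lambda>F. bop_apply g (bop_apply (\<Sum>F) v) = bop_apply g v) (finite_subsets_at_top G)"
      unfolding eventually_finite_subsets_at_top using g by (intro exI[of _ "{g}"]) auto
    then show "((\<lambda>F. bop_apply g (bop_apply (\<Sum>F) v)) \<longlongrightarrow> bop_apply g v) (finite_subsets_at_top G)"
      by (rule tendsto_eventually)
  qed simp
  then have "\<forall>g\<in>G. bop_apply g (w - v) = 0"
    by (simp add: bop_apply_diff_right)
  then have "bop_apply R (w - v) = 0"
    using R unfolding join_support_def by blast
  moreover have "bop_apply R w = w"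
  proof (rule tendsto_unique[OF _ _ w])
    have "R * \<Sum>F = \<Sum>F" if "F \<subseteq> G" for F
      unfolding sum_distrib_left using that by (intro sum.cong) (auto simp: Rg)
    then have "bop_apply R (bop_apply (\<Sum>F) v) = bop_apply (\<Sum>F) v" if "F \<subseteq> G" for F
      using that by (metis bop_apply_mult)
    then have "eventually (\<lambda>F. bop_apply R (bop_apply (\<Sum>F) v) = bop_apply (\<Sum>F) v) (finite_subsets_at_top G)"
      by (intro eventually_finite_subsets_at_top_weakI) simp
    then show "((\<lambda>F. bop_apply (\<Sum>F) v) \<longlongrightarrow> bop_apply R w) (finite_subsets_at_top G)"
      using tendsto_bop_apply[OF w] by (rule Lim_transform_eventually[rotated])
  qed simp
  ultimately show ?thesis
    using w by (simp add: bop_apply_diff_right)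
qed

section \<open>Normal functionals\<close>

lemma dual_spaceD:
  assumes "f \<in> dual_space A"
  shows "x \<in> A \<Longrightarrow> y \<in> A \<Longrightarrow> f (x + y) = f x + f y" "x \<in> A \<Longrightarrow> f (c *\<^sub>C x) = c * f x"
    "x \<notin> A \<Longrightarrow> f x = 0"
  using assms by (auto simp: dual_space_def)

lemma dual_space_add:
  assumes "f \<in> dual_space A" "g \<in> dual_space A"
  shows "(\<lambda>x. f x + g x) \<in> dual_space A"
proof -
  obtain K L where "\<forall>x\<in>A. cmod (f x) \<le> K * norm x" "\<forall>x\<in>A. cmod (g x) \<le> L * norm x"
    using assms unfolding dual_space_def by blast
  then have "cmod (f x + g x) \<le> (K + L) * norm x" if "x \<in> A" for x
    using norm_triangle_ineq[of "f x" "g x"] that by (fastforce simp: distrib_right)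
  then have "\<exists>K. \<forall>x\<in>A. cmod (f x + g x) \<le> K * norm x"
    by blast
  then show ?thesis
    using assms unfolding dual_space_def by (simp add: algebra_simps)
qed

lemma dual_space_scale:
  assumes "f \<in> dual_space A"
  shows "(\<lambda>x. c * f x) \<in> dual_space A"
proof -
  obtain K where "\<forall>x\<in>A. cmod (f x) \<le> K * norm x"
    using assms unfolding dual_space_def by blast
  then have "cmod (c * f x) \<le> (cmod c * K) * norm x" if "x \<in> A" for x
    using that by (simp add: norm_mult mult.assoc mult_left_mono)
  then have "\<exists>K. \<forall>x\<in>A. cmod (c * f x) \<le> K * norm x"
    by blast
  then show ?thesis
    using assms unfolding dual_space_def by (simp add: algebra_simps)
qed

lemma dual_space_diff:
  assumes "f \<in> dual_space A" "g \<in> dual_space A"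
  shows "(\<lambda>x. f x - g x) \<in> dual_space A"
  using dual_space_add[OF assms(1) dual_space_scale[OF assms(2), of "-1"]] by simp

lemma dual_norm_le:
  assumes "0 \<in> A" "\<And>x. x \<in> A \<Longrightarrow> cmod (f x) \<le> K * norm x" "0 \<le> K"
  shows "dual_norm A f \<le> K"
  unfolding dual_norm_def
proof (rule cSUP_least)
  show "{x \<in> A. norm x \<le> 1} \<noteq> {}"
    using assms(1) by auto
  fix x assume "x \<in> {x \<in> A. norm x \<le> 1}"
  then have "cmod (f x) \<le> K * norm x" "norm x \<le> 1"
    using assms(2) by auto
  moreover have "K * norm x \<le> K * 1"
    by (intro mult_left_mono assms) (use \<open>norm x \<le> 1\<close> in simp)
  ultimately show "cmod (f x) \<le> K"
    by simp
qed

lemma dual_norm_bound: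
  assumes A: "csubspace A" and f: "f \<in> dual_space A" and x: "x \<in> A"
  shows "cmod (f x) \<le> dual_norm A f * norm x"
proof (cases "x = 0")
  case True
  then show ?thesis
    using dual_spaceD(2)[OF f x, of 0] by simp
next
  case False
  obtain K where K: "\<And>x. x \<in> A \<Longrightarrow> cmod (f x) \<le> K * norm x"
    using f unfolding dual_space_def by blast
  have "cmod (f y) \<le> \<bar>K\<bar>" if "y \<in> A" "norm y \<le> 1" for y
  proof -
    have "K * norm y \<le> \<bar>K\<bar> * 1"
      by (intro mult_mono) (use that in auto)
    then show ?thesis
      using K[OF that(1)] by simp
  qed
  then have bdd: "bdd_above ((\<lambda>x. cmod (f x)) ` {x \<in> A. norm x \<le> 1})"
    by (intro bdd_aboveI2[of _ _ "\<bar>K\<bar>"]) auto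
  define y where "y = complex_of_real (inverse (norm x)) *\<^sub>C x"
  have y: "y \<in> A" "norm y \<le> 1"
    using csubspaceD(3)[OF A x] False by (simp_all add: y_def norm_scaleC norm_inverse)
  have "cmod (f y) \<le> dual_norm A f"
    unfolding dual_norm_def by (rule cSUP_upper[OF _ bdd]) (use y in auto)
  then have "inverse (norm x) * cmod (f x) \<le> dual_norm A f"
    by (simp add: y_def dual_spaceD(2)[OF f x] norm_mult norm_inverse)
  then show ?thesis
    using False by (simp add: field_simps)
qed

lemma dual_norm_nonneg:
  assumes "csubspace A" "f \<in> dual_space A"
  shows "0 \<le> dual_norm A f"
proof (rule ccontr)
  assume neg: "\<not> 0 \<le> dual_norm A f"
  \<comment> \<open>A negative dual norm would make \<open>f\<close> vanish on \<open>A\<close>;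
    this provides the boundedness needed to compare the supremum with the value at 0.\<close>
  have bdd: "cmod (f x) \<le> 0 * norm x" if "x \<in> A" for x
    using dual_norm_bound[OF assms that] neg norm_ge_zero[of "f x"] norm_ge_zero[of x]
    by (smt (verit) mult_nonneg_nonneg mult_nonpos_nonneg)
  have "cmod (f 0) \<le> dual_norm A f"
    unfolding dual_norm_def
    by (rule cSUP_upper) (use bdd csubspaceD(1)[OF assms(1)] in \<open>auto intro!: bdd_aboveI2[of _ _ 0]\<close>)
  then show False
    using neg norm_ge_zero[of "f 0"] by linarith
qed

lemma dual_norm_add_le:
  assumes "csubspace A" "f \<in> dual_space A" "g \<in> dual_space A"
  shows "dual_norm A (\<lambda>x. f x + g x) \<le> dual_norm A f + dual_norm A g"
proof (rule dual_norm_le)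
  show "cmod (f x + g x) \<le> (dual_norm A f + dual_norm A g) * norm x" if "x \<in> A" for x
    using norm_triangle_ineq[of "f x" "g x"] dual_norm_bound[OF assms(1,2) that]
      dual_norm_bound[OF assms(1,3) that] by (simp add: distrib_right)
qed (use assms in \<open>simp_all add: csubspaceD dual_norm_nonneg\<close>)

section \<open>Vector functionals and their norm closure\<close>

text \<open>Lists make the linear span explicit: appending lists adds functionals, and scaling the
  first entries multiplies by a scalar.\<close>

definition vector_form :: "('h :: complex_hilbert_space \<times> 'h) list \<Rightarrow> 'h bop \<Rightarrow> complex" where
  "vector_form ps x = (\<Sum>(v, w)\<leftarrow>ps. cinner (bop_apply x v) w)"

definition vector_functional ::
  "'h bop set \<Rightarrow> ('h :: complex_hilbert_space \<times> 'h) list \<Rightarrow> 'h bop \<Rightarrow> complex" where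
  "vector_functional A ps x = (if x \<in> A then vector_form ps x else 0)"

definition normal_functionals :: "'h :: complex_hilbert_space bop set \<Rightarrow> ('h bop \<Rightarrow> complex) set" where
  "normal_functionals A = {f \<in> dual_space A.
     \<forall>\<epsilon>>0. \<exists>ps. dual_norm A (\<lambda>x. f x - vector_functional A ps x) < \<epsilon>}"

lemma vector_form_simps:
  "vector_form [] x = 0"
  "vector_form ((v, w) # ps) x = cinner (bop_apply x v) w + vector_form ps x"
  "vector_form (ps @ qs) x = vector_form ps x + vector_form qs x"
  by (simp_all add: vector_form_def)

lemma vector_form_linear:
  "vector_form ps (x + y) = vector_form ps x + vector_form ps y"
  "vector_form ps (c *\<^sub>C x) = c * vector_form ps x"
  by (induction ps) (auto simp: vector_form_def cinner_add_left bop_apply_scaleC_left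
      cinner_scaleC_left algebra_simps)

lemma vector_form_scale:
  "vector_form (map (\<lambda>(v, w). (c *\<^sub>C v, w)) ps) x = c * vector_form ps x"
  by (induction ps) (auto simp: vector_form_def bop_apply_scaleC cinner_scaleC_left algebra_simps)

lemma norm_cinner_bop_apply_le: "cmod (cinner (bop_apply x v) w) \<le> (norm v * norm w) * norm x"
proof -
  have "cmod (cinner (bop_apply x v) w) \<le> norm (bop_apply x v) * norm w"
    by (rule norm_cinner_le)
  also have "\<dots> \<le> (norm x * norm v) * norm w"
    by (intro mult_right_mono norm_bop_apply) simp
  finally show ?thesis
    by (simp add: mult_ac)
qed

lemma vector_functional_in_dual:
  assumes "csubspace A"
  shows "vector_functional A ps \<in> dual_space A"
proof -
  have "\<exists>K. \<forall>x. cmod (vector_form ps x) \<le> K * norm x"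
  proof (induction ps)
    case (Cons p ps)
    obtain v w where p: "p = (v, w)"
      by (cases p)
    obtain K where K: "\<And>x. cmod (vector_form ps x) \<le> K * norm x"
      using Cons by blast
    have "cmod (vector_form (p # ps) x) \<le> (norm v * norm w + K) * norm x" for x
      unfolding p vector_form_simps
      using norm_triangle_le[OF add_mono[OF norm_cinner_bop_apply_le K]] by (simp add: distrib_right)
    then show ?case
      by blast
  qed (auto simp: vector_form_simps intro: exI[of _ 0])
  then show ?thesis
    using assms by (auto simp: dual_space_def vector_functional_def vector_form_linear csubspace_def)
qed

lemma normal_functionals_sub_dual: "normal_functionals A \<subseteq> dual_space A"
  by (auto simp: normal_functionals_def)

lemma normal_functionals_approx:
  assumes "f \<in> normal_functionals A" "0 < \<epsilon>"
  shows "\<exists>ps. dual_norm A (\<lambda>x. f x - vector_functional A ps x) < \<epsilon>"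
  using assms by (simp add: normal_functionals_def)

lemma vector_functional_normal:
  assumes "csubspace A"
  shows "vector_functional A ps \<in> normal_functionals A"
proof -
  have "dual_norm A (\<lambda>x. vector_functional A ps x - vector_functional A ps x) \<le> 0"
    by (rule dual_norm_le) (use assms in \<open>auto simp: csubspaceD\<close>)
  then have "dual_norm A (\<lambda>x. vector_functional A ps x - vector_functional A ps x) < \<epsilon>" if "0 < \<epsilon>" for \<epsilon>
    using that by linarith
  then show ?thesis
    unfolding normal_functionals_def using vector_functional_in_dual[OF assms] by blast
qed

lemma normal_functionals_add:
  assumes A: "csubspace A" and f: "f \<in> normal_functionals A" and g: "g \<in> normal_functionals A"
  shows "(\<lambda>x. f x + g x) \<in> normal_functionals A"
proof -
  note d = subsetD[OF normal_functionals_sub_dual f] subsetD[OF normal_functionals_sub_dual g]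
  have "\<exists>ps. dual_norm A (\<lambda>x. (f x + g x) - vector_functional A ps x) < \<epsilon>" if \<epsilon>: "0 < \<epsilon>" for \<epsilon>
  proof -
    obtain ps where ps: "dual_norm A (\<lambda>x. f x - vector_functional A ps x) < \<epsilon> / 2"
      using normal_functionals_approx[OF f half_gt_zero[OF \<epsilon>]] by blast
    obtain qs where qs: "dual_norm A (\<lambda>x. g x - vector_functional A qs x) < \<epsilon> / 2"
      using normal_functionals_approx[OF g half_gt_zero[OF \<epsilon>]] by blast
    have "(\<lambda>x. (f x + g x) - vector_functional A (ps @ qs) x) =
        (\<lambda>x. (f x - vector_functional A ps x) + (g x - vector_functional A qs x))"
      by (auto simp: vector_functional_def vector_form_simps)
    then have "dual_norm A (\<lambda>x. (f x + g x) - vector_functional A (ps @ qs) x) \<le>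
        dual_norm A (\<lambda>x. f x - vector_functional A ps x) + dual_norm A (\<lambda>x. g x - vector_functional A qs x)"
      using dual_norm_add_le[OF A dual_space_diff[OF d(1) vector_functional_in_dual[OF A]]
          dual_space_diff[OF d(2) vector_functional_in_dual[OF A]]] by simp
    then show ?thesis
      using ps qs by (intro exI[of _ "ps @ qs"]) linarith
  qed
  then show ?thesis
    using dual_space_add[OF d] by (simp add: normal_functionals_def)
qed

lemma normal_functionals_scale:
  assumes A: "csubspace A" and f: "f \<in> normal_functionals A"
  shows "(\<lambda>x. c * f x) \<in> normal_functionals A"
proof -
  note d = subsetD[OF normal_functionals_sub_dual f]
  have "\<exists>ps. dual_norm A (\<lambda>x. c * f x - vector_functional A ps x) < \<epsilon>" if \<epsilon>: "0 < \<epsilon>" for \<epsilon>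
  proof -
    \<comment> \<open>The summand 1 keeps the denominator positive when
      \<open>c = 0\<close>.\<close>
    define \<delta> where "\<delta> = \<epsilon> / (cmod c + 1)"
    have pos: "0 < cmod c + 1"
      using norm_ge_zero[of c] by linarith
    have \<delta>: "0 < \<delta>" "cmod c * \<delta> < \<epsilon>"
      using \<epsilon> pos by (auto simp: \<delta>_def field_simps)
    obtain ps where ps: "dual_norm A (\<lambda>x. f x - vector_functional A ps x) < \<delta>"
      using normal_functionals_approx[OF f \<delta>(1)] by blast
    define qs where "qs = map (\<lambda>(v, w). (c *\<^sub>C v, w)) ps"
    let ?g = "\<lambda>x. f x - vector_functional A ps x"
    have "dual_norm A (\<lambda>x. c * f x - vector_functional A qs x) \<le> cmod c * dual_norm A ?g"
    proof (rule dual_norm_le)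
      fix x assume x: "x \<in> A"
      have "c * f x - vector_functional A qs x = c * ?g x"
        using x by (simp add: vector_functional_def qs_def vector_form_scale right_diff_distrib)
      then show "cmod (c * f x - vector_functional A qs x) \<le> cmod c * dual_norm A ?g * norm x"
        using dual_norm_bound[OF A dual_space_diff[OF d vector_functional_in_dual[OF A]] x]
        by (simp add: norm_mult mult.assoc mult_left_mono)
    qed (use A in \<open>simp_all add: csubspaceD dual_norm_nonneg d dual_space_diff vector_functional_in_dual\<close>)
    also have "\<dots> \<le> cmod c * \<delta>"
      using ps by (intro mult_left_mono) auto
    finally show ?thesis
      using \<delta>(2) by (intro exI[of _ qs]) linarith
  qed
  then show ?thesis
    using dual_space_scale[OF d] by (simp add: normal_functionals_def)
qed

text \<open>The assumption \<open>bipolar\<close> says that \<open>A\<close> is its own double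
  annihilator with respect to vector forms. It is what places the operator representing
  \<open>\<psi>\<close> back in \<open>A\<close>; agreement on all normal functionals then follows
  from density and boundedness.\<close>

lemma predual_normal_functionals:
  fixes A :: "'h :: complex_hilbert_space bop set"
  assumes A: "csubspace A"
    and bipolar: "\<And>a. (\<And>ps. (\<And>x. x \<in> A \<Longrightarrow> vector_form ps x = 0) \<Longrightarrow> vector_form ps a = 0) \<Longrightarrow> a \<in> A"
  shows "predual A (normal_functionals A)"
  unfolding predual_def
proof (intro conjI ballI allI impI)
  let ?F = "normal_functionals A"
  note d = subsetD[OF normal_functionals_sub_dual]
  note vd = vector_functional_in_dual[OF A]
  show "?F \<subseteq> dual_space A"
    by (rule normal_functionals_sub_dual)
  have "(\<lambda>x. 0) = vector_functional A []"
    by (auto simp: vector_functional_def vector_form_simps)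
  then show zero: "(\<lambda>x. 0) \<in> ?F"
    using vector_functional_normal[OF A] by metis
  show "(\<lambda>x. f x + g x) \<in> ?F" if "f \<in> ?F" "g \<in> ?F" for f g
    by (rule normal_functionals_add[OF A that])
  show "(\<lambda>x. c * f x) \<in> ?F" if "f \<in> ?F" for c f
    by (rule normal_functionals_scale[OF A that])
  show "g \<in> ?F" if g: "g \<in> dual_space A" and lim: "\<forall>\<epsilon>>0. \<exists>f\<in>?F. dual_norm A (\<lambda>x. g x - f x) < \<epsilon>" for g
  proof -
    have "\<exists>ps. dual_norm A (\<lambda>x. g x - vector_functional A ps x) < \<epsilon>" if \<epsilon>: "0 < \<epsilon>" for \<epsilon>
    proof -
      obtain f where f: "f \<in> ?F" "dual_norm A (\<lambda>x. g x - f x) < \<epsilon> / 2"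
        using lim \<open>0 < \<epsilon>\<close> half_gt_zero by blast
      obtain ps where ps: "dual_norm A (\<lambda>x. f x - vector_functional A ps x) < \<epsilon> / 2"
        using normal_functionals_approx[OF f(1) half_gt_zero[OF \<epsilon>]] by blast
      have "dual_norm A (\<lambda>x. g x - vector_functional A ps x) < \<epsilon>"
        using dual_norm_add_le[OF A dual_space_diff[OF g d[OF f(1)]] dual_space_diff[OF d[OF f(1)] vd[of ps]]]
          f(2) ps by simp
      then show ?thesis ..
    qed
    then show ?thesis
      using g by (simp add: normal_functionals_def)
  qed
  show "norm a = (SUP f\<in>{f \<in> ?F. dual_norm A f \<le> 1}. cmod (f a))" if a: "a \<in> A" for a
  proof (rule antisym)
    let ?B = "{f \<in> ?F. dual_norm A f \<le> 1}"
    have le: "cmod (f a) \<le> norm a" if "f \<in> ?B" for f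
    proof -
      have "cmod (f a) \<le> dual_norm A f * norm a"
        using dual_norm_bound[OF A d a] that by simp
      also have "\<dots> \<le> 1 * norm a"
        using that by (intro mult_right_mono) auto
      finally show ?thesis by simp
    qed
    have zB: "(\<lambda>x. 0) \<in> ?B"
      using zero dual_norm_le[of A "\<lambda>x. 0" 0] A by (auto simp: csubspaceD)
    then have "?B \<noteq> {}"
      by blast
    then show "(SUP f\<in>?B. cmod (f a)) \<le> norm a"
      by (rule cSUP_least) (rule le)
    have upper: "cmod (f a) \<le> (SUP f\<in>?B. cmod (f a))" if "f \<in> ?B" for f
      by (rule cSUP_upper[OF that]) (use le in \<open>auto intro!: bdd_aboveI2[of _ _ "norm a"]\<close>)
    show "norm a \<le> (SUP f\<in>?B. cmod (f a))"
    proof (rule norm_bop_bound)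
      show "0 \<le> (SUP f\<in>?B. cmod (f a))"
        using upper[OF zB] by simp
      fix v
      show "norm (bop_apply a v) \<le> (SUP f\<in>?B. cmod (f a)) * norm v"
      proof (cases "bop_apply a v = 0 \<or> v = 0")
        case True
        then show ?thesis
          using upper[OF zB] by auto
      next
        case False
        \<comment> \<open>The unit vectors \<open>u\<close> and \<open>w\<close> give a functional
          of norm at most 1 whose value at \<open>a\<close> is exactly
          \<open>norm (bop_apply a v) / norm v\<close>.\<close>
        define u where "u = complex_of_real (inverse (norm v)) *\<^sub>C v"
        define w where "w = complex_of_real (inverse (norm (bop_apply a v))) *\<^sub>C bop_apply a v"
        have n: "norm u = 1" "norm w = 1"
          using False by (simp_all add: u_def w_def norm_scaleC norm_inverse)
        have "dual_norm A (vector_functional A [(u, w)]) \<le> 1"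
          using norm_cinner_bop_apply_le[of _ u w] n A
          by (intro dual_norm_le) (auto simp: csubspaceD vector_functional_def vector_form_simps)
        then have "cmod (vector_functional A [(u, w)] a) \<le> (SUP f\<in>?B. cmod (f a))"
          using vector_functional_normal[OF A] by (intro upper) simp
        moreover have "vector_functional A [(u, w)] a = norm (bop_apply a v) / norm v"
          using False a by (simp add: vector_functional_def vector_form_simps u_def w_def bop_apply_scaleC
              cinner_scaleC_left cinner_scaleC_right cinner_self power2_eq_square field_simps)
        ultimately have "norm (bop_apply a v) / norm v \<le> (SUP f\<in>?B. cmod (f a))"
          by (simp add: norm_divide)
        then show ?thesis
          using False by (simp add: field_simps)
      qed
    qed
  qed
  show "\<exists>a\<in>A. \<forall>f\<in>?F. \<psi> f = f a"
    if \<psi>: "(\<forall>f\<in>?F. \<forall>g\<in>?F. \<psi> (\<lambda>x. f x + g x) = \<psi> f + \<psi> g) \<and>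
      (\<forall>c. \<forall>f\<in>?F. \<psi> (\<lambda>x. c * f x) = c * \<psi> f) \<and>
      (\<exists>K. \<forall>f\<in>?F. cmod (\<psi> f) \<le> K * dual_norm A f)" for \<psi> :: "('h bop \<Rightarrow> complex) \<Rightarrow> complex"
  proof -
    let ?v = "vector_functional A"
    note vn = vector_functional_normal[OF A]
    have add: "\<psi> (\<lambda>x. f x + g x) = \<psi> f + \<psi> g" if "f \<in> ?F" "g \<in> ?F" for f g
      using \<psi> that by blast
    have scale: "\<psi> (\<lambda>x. c * f x) = c * \<psi> f" if "f \<in> ?F" for f c
      using \<psi> that by blast
    obtain K0 where K0: "\<forall>f\<in>?F. cmod (\<psi> f) \<le> K0 * dual_norm A f"
      using \<psi> by blast
    define K where "K = \<bar>K0\<bar>"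
    have K: "cmod (\<psi> f) \<le> K * dual_norm A f" "0 \<le> K" if "f \<in> ?F" for f
      using K0[rule_format, OF that] mult_right_mono[OF abs_ge_self[of K0] dual_norm_nonneg[OF A d[OF that]]]
      by (auto simp: K_def)
    \<comment> \<open>Restricted to single vector functionals, \<open>\<psi>\<close> is a bounded
      sesquilinear form, so an operator \<open>T\<close> represents it.\<close>
    define b where "b v w = \<psi> (?v [(v, w)])" for v w
    obtain T where T: "\<And>v w. cinner (bop_apply T v) w = b v w"
    proof (rule ex_bop_sesquilinear[of b K])
      have "?v [(x + y, z)] = (\<lambda>a. ?v [(x, z)] a + ?v [(y, z)] a)" for x y z
        by (auto simp: vector_functional_def vector_form_simps bop_apply_add_right cinner_add_left)
      then show "b (x + y) z = b x z + b y z" for x y z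
        by (simp add: b_def add vn)
      have "?v [(z, x + y)] = (\<lambda>a. ?v [(z, x)] a + ?v [(z, y)] a)" for x y z
        by (auto simp: vector_functional_def vector_form_simps cinner_add_right)
      then show "b z (x + y) = b z x + b z y" for x y z
        by (simp add: b_def add vn)
      have "?v [(c *\<^sub>C x, z)] = (\<lambda>a. c * ?v [(x, z)] a)" for c x z
        by (auto simp: vector_functional_def vector_form_simps bop_apply_scaleC cinner_scaleC_left)
      then show "b (c *\<^sub>C x) z = c * b x z" for c x z
        by (simp add: b_def scale vn)
      have "?v [(z, c *\<^sub>C x)] = (\<lambda>a. cnj c * ?v [(z, x)] a)" for c x z
        by (auto simp: vector_functional_def vector_form_simps cinner_scaleC_right)
      then show "b z (c *\<^sub>C x) = cnj c * b z x" for c x z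
        by (simp add: b_def scale vn)
      show "cmod (b x y) \<le> K * norm x * norm y" for x y
      proof -
        have "dual_norm A (?v [(x, y)]) \<le> norm x * norm y"
          using norm_cinner_bop_apply_le[of _ x y] A
          by (intro dual_norm_le) (auto simp: csubspaceD vector_functional_def vector_form_simps)
        then have "K * dual_norm A (?v [(x, y)]) \<le> K * (norm x * norm y)"
          using K(2)[OF vn] by (rule mult_left_mono)
        then show ?thesis
          using K(1)[OF vn, of "[(x, y)]"] by (simp add: b_def mult.assoc)
      qed
    qed blast
    have \<psi>0: "\<psi> (\<lambda>x. 0) = 0"
      using scale[OF zero, of 0] by simp
    have \<psi>v: "\<psi> (?v ps) = vector_form ps T" for ps
    proof (induction ps)
      case Nil
      have "?v [] = (\<lambda>x. 0)"
        by (auto simp: vector_functional_def vector_form_simps)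
      then show ?case
        using \<psi>0 by (simp add: vector_form_simps)
    next
      case (Cons p ps)
      obtain v w where p: "p = (v, w)"
        by (cases p)
      have "?v (p # ps) = (\<lambda>x. ?v [p] x + ?v ps x)"
        by (auto simp: vector_functional_def vector_form_simps p)
      then show ?case
        using Cons T[of v w] by (simp add: add vn vector_form_simps p b_def)
    qed
    have TA: "T \<in> A"
    proof (rule bipolar)
      \<comment> \<open>A vector form vanishing on \<open>A\<close> becomes the zero function once
        it is cut off outside \<open>A\<close>, and \<open>\<psi>\<close> maps that to 0.\<close>
      fix ps assume "\<And>x. x \<in> A \<Longrightarrow> vector_form ps x = 0"
      then have "?v ps = (\<lambda>x. 0)"
        by (auto simp: vector_functional_def)
      then show "vector_form ps T = 0"
        using \<psi>v[of ps] \<psi>0 by simp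
    qed
    have "\<psi> f = f T" if f: "f \<in> ?F" for f
    proof -
      have "cmod (\<psi> f - f T) \<le> 0 + \<epsilon>" if \<epsilon>: "0 < \<epsilon>" for \<epsilon>
      proof -
        \<comment> \<open>The approximation error is seen by \<open>\<psi>\<close> with factor
          \<open>K\<close> and by evaluation at \<open>T\<close> with factor \<open>norm T\<close>;
          the 1 avoids a zero denominator.\<close>
        define \<delta> where "\<delta> = \<epsilon> / (K + norm T + 1)"
        have pos: "0 < K + norm T + 1"
          using K(2)[OF zero] norm_ge_zero[of T] by linarith
        have \<delta>: "0 < \<delta>" "(K + norm T) * \<delta> \<le> \<epsilon>"
          using \<epsilon> pos by (auto simp: \<delta>_def field_simps)
        obtain ps where ps: "dual_norm A (\<lambda>x. f x - ?v ps x) < \<delta>"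
          using normal_functionals_approx[OF f \<delta>(1)] by blast
        let ?g = "\<lambda>x. f x - ?v ps x"
        have m: "(\<lambda>x. - 1 * ?v ps x) \<in> ?F"
          by (rule normal_functionals_scale[OF A vn])
        have gF: "?g \<in> ?F"
          using normal_functionals_add[OF A f m] by simp
        have "\<psi> ?g = \<psi> f - \<psi> (?v ps)"
          using add[OF f m] scale[OF vn, of "-1" ps] by simp
        then have "\<psi> f - f T = \<psi> ?g - ?g T"
          using TA by (simp add: \<psi>v vector_functional_def)
        then have "cmod (\<psi> f - f T) \<le> cmod (\<psi> ?g) + cmod (?g T)"
          by (metis norm_triangle_ineq4)
        also have "\<dots> \<le> K * dual_norm A ?g + dual_norm A ?g * norm T"
          by (intro add_mono K(1) gF dual_norm_bound A d TA)
        also have "\<dots> = (K + norm T) * dual_norm A ?g"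
          by (simp add: algebra_simps)
        also have "\<dots> \<le> (K + norm T) * \<delta>"
          using ps K(2)[OF zero] by (intro mult_left_mono) auto
        finally show ?thesis
          using \<delta>(2) by linarith
      qed
      then have "cmod (\<psi> f - f T) \<le> 0"
        by (rule field_le_epsilon)
      then show ?thesis by simp
    qed
    then show ?thesis
      using TA by blast
  qed
qed

section \<open>Convergence in the weak* topology\<close>

text \<open>Convergence needs testing only on the generating sets, by induction over the generated
  topology. The zero functional in \<open>F\<close> makes \<open>A\<close> itself a generating set,
  so that \<open>a\<close> lies in the topological space.\<close>

lemma limitin_weak_star:
  assumes F: "(\<lambda>x. 0) \<in> F" and a: "a \<in> A"
    and A: "eventually (\<lambda>i. X i \<in> A) N"
    and lim: "\<And>f. f \<in> F \<Longrightarrow> ((\<lambda>i. f (X i)) \<longlongrightarrow> f a) N"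
  shows "limitin (weak_star_topology A F) X a N"
  unfolding limitin_def
proof (intro conjI allI impI)
  let ?S = "{{a \<in> A. f a \<in> U} | f U. f \<in> F \<and> open U}"
  have "A = {a \<in> A. (\<lambda>x. 0) a \<in> UNIV}"
    by simp
  then have "A \<in> ?S"
    using F open_UNIV by blast
  then show "a \<in> topspace (weak_star_topology A F)"
    using a unfolding weak_star_topology_def topology_generated_by_topspace by blast
  fix U assume "openin (weak_star_topology A F) U \<and> a \<in> U"
  then have "generate_topology_on ?S U" "a \<in> U"
    by (auto simp: weak_star_topology_def openin_topology_generated_by_iff)
  then show "eventually (\<lambda>i. X i \<in> U) N"
  proof (induction rule: generate_topology_on.induct)
    case (Basis s)
    then obtain f V where s: "s = {a \<in> A. f a \<in> V}" "f \<in> F" "open V"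
      by blast
    then have "eventually (\<lambda>i. f (X i) \<in> V) N"
      using topological_tendstoD[OF lim] Basis by blast
    with A show ?case
      by eventually_elim (simp add: s)
  next
    case (Int U V)
    then show ?case
      by (auto intro: eventually_conj)
  next
    case (UN \<U>)
    then obtain V where "V \<in> \<U>" "a \<in> V"
      by blast
    with UN have "eventually (\<lambda>i. X i \<in> V) N"
      by blast
    then show ?case
      by eventually_elim (use \<open>V \<in> \<U>\<close> in blast)
  qed simp
qed

lemma topspace_weak_star: "topspace (weak_star_topology A F) \<subseteq> A"
  unfolding weak_star_topology_def topology_generated_by_topspace by blast

text \<open>Strong convergence gives convergence of every vector form, and the norm bound
  \<open>C\<close> transfers this to norm limits of vector functionals. So bounded strong limits are
  weak* limits.\<close>

lemma closedin_weak_star_limit: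
  fixes A :: "'h :: complex_hilbert_space bop set"
  assumes A: "csubspace A" and I: "closedin (weak_star_topology A (normal_functionals A)) I"
    and N: "N \<noteq> bot" and ev: "eventually (\<lambda>i. X i \<in> I) N"
    and bound: "eventually (\<lambda>i. norm (X i) \<le> C) N"
    and lim: "\<And>v. ((\<lambda>i. bop_apply (X i) v) \<longlongrightarrow> bop_apply a v) N" and a: "a \<in> A"
  shows "a \<in> I"
proof (rule limitin_closedin[OF _ I ev])
  have evA: "eventually (\<lambda>i. X i \<in> A) N"
    using ev by eventually_elim (use order_trans[OF closedin_subset[OF I] topspace_weak_star] in blast)
  show "limitin (weak_star_topology A (normal_functionals A)) X a N"
  proof (rule limitin_weak_star[OF _ a evA])
    have "(\<lambda>x. 0) = vector_functional A []"
      by (auto simp: vector_functional_def vector_form_simps)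
    then show "(\<lambda>x. 0) \<in> normal_functionals A"
      using vector_functional_normal[OF A] by metis
    fix f assume f: "f \<in> normal_functionals A"
    show "((\<lambda>i. f (X i)) \<longlongrightarrow> f a) N"
    proof (rule tendstoI)
      fix \<epsilon> :: real assume \<epsilon>: "0 < \<epsilon>"
      \<comment> \<open>Replacing \<open>f\<close> by a vector form costs at most
        \<open>\<epsilon> / 2\<close> at \<open>X i\<close> and \<open>a\<close> together; the other
        half is left for the convergence of that form.\<close>
      define \<delta> where "\<delta> = \<epsilon> / (2 * (\<bar>C\<bar> + norm a + 1))"
      have pos: "0 < \<bar>C\<bar> + norm a + 1"
        using norm_ge_zero[of a] by linarith
      have \<delta>: "0 < \<delta>" "(\<bar>C\<bar> + norm a) * \<delta> \<le> \<epsilon> / 2"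
        using \<epsilon> pos by (auto simp: \<delta>_def field_simps)
      obtain ps where ps: "dual_norm A (\<lambda>x. f x - vector_functional A ps x) < \<delta>"
        using normal_functionals_approx[OF f \<delta>(1)] by blast
      have g: "cmod (f x - vector_form ps x) \<le> \<delta> * norm x" if "x \<in> A" for x
      proof -
        have "cmod (f x - vector_functional A ps x) \<le>
            dual_norm A (\<lambda>x. f x - vector_functional A ps x) * norm x"
          using dual_norm_bound[OF A dual_space_diff[OF subsetD[OF normal_functionals_sub_dual f]
              vector_functional_in_dual[OF A]] that] .
        also have "\<dots> \<le> \<delta> * norm x"
          using ps by (intro mult_right_mono) auto
        finally show ?thesis
          using that by (simp add: vector_functional_def)
      qed
      have "((\<lambda>i. vector_form ps (X i)) \<longlongrightarrow> vector_form ps a) N"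
      proof (induction ps)
        case (Cons p ps)
        obtain v w where p: "p = (v, w)"
          by (cases p)
        have "bounded_linear (\<lambda>x. cinner x w)"
          by (rule bounded_linear_intro[of _ "norm w"])
            (simp_all add: cinner_add_left scaleR_scaleC cinner_scaleC_left norm_cinner_le scaleR_conv_of_real)
        from bounded_linear.tendsto[OF this lim[of v]] show ?case
          unfolding p vector_form_simps by (intro tendsto_add Cons)
      qed (simp add: vector_form_simps)
      from tendstoD[OF this, of "\<epsilon> / 2"] \<epsilon>
      have "eventually (\<lambda>i. dist (vector_form ps (X i)) (vector_form ps a) < \<epsilon> / 2) N"
        by simp
      with evA bound show "eventually (\<lambda>i. dist (f (X i)) (f a) < \<epsilon>) N"
      proof eventually_elim
        case (elim i)
        have "\<delta> * norm (X i) \<le> \<delta> * \<bar>C\<bar>"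
          using elim \<delta>(1) by (intro mult_left_mono) auto
        then have "cmod (f (X i) - vector_form ps (X i)) + cmod (f a - vector_form ps a) \<le> \<epsilon> / 2"
          using g[OF elim(1)] g[OF a] \<delta>(2) by (simp add: algebra_simps)
        moreover have "dist (f (X i)) (f a) \<le> dist (vector_form ps (X i)) (vector_form ps a)
            + (cmod (f (X i) - vector_form ps (X i)) + cmod (f a - vector_form ps a))"
        proof -
          have "f (X i) - f a = (vector_form ps (X i) - vector_form ps a) +
              ((f (X i) - vector_form ps (X i)) - (f a - vector_form ps a))"
            by simp
          then show ?thesis
            unfolding dist_norm by (metis norm_triangle_le norm_triangle_ineq4 add_left_mono)
        qed
        ultimately show ?case
          using elim by linarith
      qed
    qed
  qed
qed (rule N)

section \<open>Abelian projections and Jordan ideals\<close>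

text \<open>The form of Zorn's lemma behind both exhaustions: an element compatible with the whole
  family already belongs to it. When \<open>Q\<close> is an orthogonality relation this contradicts
  the element being nonzero. As \<open>Q\<close> may be asymmetric, compatibility is required in
  both orders.\<close>

lemma ex_maximal_clique:
  "\<exists>G. (\<forall>g\<in>G. P g) \<and> (\<forall>g\<in>G. \<forall>h\<in>G. g \<noteq> h \<longrightarrow> Q g h) \<and>
     (\<forall>x. P x \<and> (\<forall>g\<in>G. Q x g \<and> Q g x) \<longrightarrow> x \<in> G)"
proof -
  define \<G> where "\<G> = {G. (\<forall>g\<in>G. P g) \<and> (\<forall>g\<in>G. \<forall>h\<in>G. g \<noteq> h \<longrightarrow> Q g h)}"
  have "\<exists>G\<in>\<G>. \<forall>X\<in>\<G>. G \<subseteq> X \<longrightarrow> X = G"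
  proof (rule subset_Zorn')
    fix \<C> assume "subset.chain \<G> \<C>"
    then have sub: "\<C> \<subseteq> \<G>" and chain: "\<And>X Y. X \<in> \<C> \<Longrightarrow> Y \<in> \<C> \<Longrightarrow> X \<subseteq> Y \<or> Y \<subseteq> X"
      by (auto simp: subset_chain_def)
    have "Q g h" if g: "g \<in> X" "X \<in> \<C>" and h: "h \<in> Y" "Y \<in> \<C>" and "g \<noteq> h" for g h X Y
    proof -
      have "\<exists>Z\<in>\<G>. g \<in> Z \<and> h \<in> Z"
        using chain[OF g(2) h(2)] g h sub by blast
      then show ?thesis
        using \<open>g \<noteq> h\<close> by (auto simp: \<G>_def)
    qed
    moreover have "P g" if "g \<in> X" "X \<in> \<C>" for g X
      using that sub by (auto simp: \<G>_def)
    ultimately show "\<Union>\<C> \<in> \<G>"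
      by (auto simp: \<G>_def)
  qed
  then obtain G where G: "G \<in> \<G>" and max: "\<And>X. X \<in> \<G> \<Longrightarrow> G \<subseteq> X \<Longrightarrow> X = G"
    by blast
  have "x \<in> G" if "P x" "\<forall>g\<in>G. Q x g \<and> Q g x" for x
  proof -
    have "insert x G \<in> \<G>"
      using G that by (simp add: \<G>_def)
    then have "insert x G = G"
      by (rule max) auto
    then show ?thesis
      by blast
  qed
  then show ?thesis
    using G unfolding \<G>_def by (intro exI[of _ G]) simp
qed

lemma von_neumann_algebra_closed:
  assumes "von_neumann_algebra M"
  shows "0 \<in> M" "x \<in> M \<Longrightarrow> y \<in> M \<Longrightarrow> x + y \<in> M" "x \<in> M \<Longrightarrow> y \<in> M \<Longrightarrow> x - y \<in> M"
    "x \<in> M \<Longrightarrow> r *\<^sub>R x \<in> M" "x \<in> M \<Longrightarrow> y \<in> M \<Longrightarrow> x * y \<in> M" "x \<in> M \<Longrightarrow> star x \<in> M"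
  using assms by (simp_all add: von_neumann_algebraD csubspaceD)

lemma join_supportD:
  assumes "join_support S R"
  shows "projection R" "b \<in> S \<Longrightarrow> b * R = b"
    "(\<And>b. b \<in> S \<Longrightarrow> bop_apply b v = 0) \<Longrightarrow> bop_apply R v = 0"
  using assms by (auto simp: join_support_def)

lemma join_support_annihilates:
  assumes "join_support S R" "\<And>b. b \<in> S \<Longrightarrow> b * x = 0"
  shows "R * x = 0"
proof (rule bop_eqI)
  fix v
  have "bop_apply b (bop_apply x v) = 0" if "b \<in> S" for b
    using assms(2)[OF that] by (metis bop_apply_mult bop_apply_zero)
  then show "bop_apply (R * x) v = bop_apply 0 v"
    using join_supportD(3)[OF assms(1)] by simp
qed

lemma join_support_below:
  assumes R: "join_support S R" and b: "\<And>b. b \<in> S \<Longrightarrow> b * q = b" and q: "star q = q"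
  shows "R * q = R" "q * R = R"
proof -
  have sR: "star R = R"
    using join_supportD(1)[OF R] by (simp add: projection_def)
  show 1: "R * q = R"
  proof (rule bop_eqI)
    fix v
    have "bop_apply R (v - bop_apply q v) = 0"
    proof (rule join_supportD(3)[OF R])
      fix b assume "b \<in> S"
      then have "bop_apply b (bop_apply q v) = bop_apply b v"
        using b by (metis bop_apply_mult)
      then show "bop_apply b (v - bop_apply q v) = 0"
        by (simp add: bop_apply_diff_right)
    qed
    then show "bop_apply (R * q) v = bop_apply R v"
      by (simp add: bop_apply_diff_right)
  qed
  show "q * R = R"
    using arg_cong[OF 1, of star] by (simp add: star_mult sR q)
qed

text \<open>The kernel of \<open>star x\<close> is the orthogonal complement of the range of
  \<open>x\<close>, so \<open>R\<close> is the range projection of \<open>x\<close>.\<close>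

lemma left_support:
  assumes R: "join_support {star x} R"
  shows "R * x = x" "star x * y = 0 \<Longrightarrow> R * y = 0"
proof -
  have "star x * R = star x"
    by (rule join_supportD(2)[OF R]) simp
  from arg_cong[OF this, of star] show "R * x = x"
    using join_supportD(1)[OF R] by (simp add: star_mult star_star projection_def)
  show "R * y = 0" if "star x * y = 0"
    by (rule join_support_annihilates[OF R]) (simp add: that)
qed

text \<open>Sandwiching between \<open>star x\<close> and \<open>x\<close> moves \<open>M\<close>
  into the commutative algebra \<open>p M p\<close>. A commutation relation obtained there is
  carried over to \<open>l M l\<close>, because \<open>l\<close> is a strong limit of elements
  \<open>x * c * star x\<close> and \<open>star x * y = 0\<close> implies
  \<open>l * y = 0\<close>.\<close>

lemma ex_abelian_projection_below:
  fixes M :: "'h :: complex_hilbert_space bop set"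
  assumes M: "von_neumann_algebra M" and I: "type_I M"
    and z: "z \<in> M" "projection z" "z \<noteq> 0"
  obtains l where "abelian_projection M l" "l \<noteq> 0" "z * l = l"
proof -
  note cl = von_neumann_algebra_closed[OF M]
  \<comment> \<open>The common kernel of \<open>z M\<close> is invariant under \<open>M\<close>, so
    its support \<open>C\<close> is central: it is the central support of \<open>z\<close>.\<close>
  define S where "S = (\<lambda>y. z * y) ` M"
  obtain C where C: "join_support S C"
    by (rule ex_join_support)
  have CM: "C \<in> M"
    by (rule join_support_in[OF M _ C]) (auto simp: S_def intro: cl z)
  have kill: "bop_apply b (bop_apply y v) = 0"
    if v: "\<And>c. c \<in> S \<Longrightarrow> bop_apply c v = 0" and b: "b \<in> S" and y: "y \<in> M" for b y v
  proof -
    obtain a where a: "a \<in> M" "b = z * a"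
      using b by (auto simp: S_def)
    then have "z * (a * y) \<in> S"
      using cl y by (auto simp: S_def)
    from v[OF this] show ?thesis
      by (simp add: a)
  qed
  have "C * y = y * C" if "y \<in> M" for y
    by (rule join_support_commute[OF C]; rule kill) (assumption | rule that cl)+
  then have cC: "central_projection M C"
    using CM join_supportD(1)[OF C] by (simp add: central_projection_def)
  have "z \<in> S"
    using z by (auto simp: S_def projection_def intro!: image_eqI[of _ _ z])
  then have "z * C = z"
    by (rule join_supportD(2)[OF C])
  then have "C \<noteq> 0"
    using z by auto
  then obtain p where p: "abelian_projection M p" "p \<noteq> 0" "C * p = p"
    using I cC unfolding type_I_def by blast
  have pM: "p \<in> M" "star p = p" "p * p = p"
    using p by (auto simp: abelian_projection_def projection_def)
  have "\<exists>y\<in>M. z * y * p \<noteq> 0"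
  proof (rule ccontr)
    assume "\<not> ?thesis"
    then have "C * p = 0"
      by (intro join_support_annihilates[OF C]) (auto simp: S_def)
    then show False
      using p by simp
  qed
  then obtain y where y: "y \<in> M" "z * y * p \<noteq> 0"
    by blast
  \<comment> \<open>The normalization meets the contraction hypothesis of
    \<open>range_approx\<close>.\<close>
  define x where "x = (1 / norm (z * y * p)) *\<^sub>R (z * y * p)"
  have xM: "x \<in> M"
    unfolding x_def by (intro cl y z pM)
  have x: "norm x = 1" "z * x = x" "x * p = x"
    using y z pM by (simp_all add: x_def projection_def mult.assoc[symmetric])
      (simp add: mult.assoc)
  have px: "p * star x = star x"
    using arg_cong[OF x(3), of star] by (simp add: star_mult pM)
  obtain l where l: "join_support {star x} l"
    by (rule ex_join_support)
  have lM: "l \<in> M"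
    by (rule join_support_in[OF M _ l]) (simp add: cl xM)
  have lP: "projection l"
    by (rule join_supportD(1)[OF l])
  have "star x * z = star x"
    using arg_cong[OF x(2), of star] z by (simp add: star_mult projection_def)
  then have zl: "z * l = l"
    using z by (intro join_support_below[OF l]) (auto simp: projection_def)
  have "l \<noteq> 0"
    using left_support(1)[OF l] x(1) by auto
  have comm: "(p * a * p) * (p * b * p) = (p * b * p) * (p * a * p)" if "a \<in> M" "b \<in> M" for a b
    using p(1) that by (auto simp: abelian_projection_def)
  \<comment> \<open>As \<open>x * p = x\<close>, the elements \<open>star x * a * x\<close> and
    \<open>star x * b * x\<close> lie in \<open>p M p\<close>, and between them \<open>c\<close> may
    be replaced by \<open>p * c * p\<close>; the three factors then commute.\<close>
  have swap: "star x * a * (x * c * star x) * b * x = star x * b * (x * c * star x) * a * x"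
    if "a \<in> M" "b \<in> M" "c \<in> M" for a b c
  proof -
    define a' b' where "a' = star x * a * x" and "b' = star x * b * x"
    have M': "a' \<in> M" "b' \<in> M"
      unfolding a'_def b'_def by (intro cl that xM)+
    have p': "p * a' = a'" "a' * p = a'" "p * b' = b'" "b' * p = b'"
      by (simp_all add: a'_def b'_def mult.assoc[symmetric] px) (simp_all add: mult.assoc x)
    have ab: "a' * b' = b' * a'"
      using comm[OF M'] by (simp add: p')
    have ac: "a' * (p * c * p) = (p * c * p) * a'"
      using comm[OF M'(1) that(3)] by (simp add: p')
    have bc: "b' * (p * c * p) = (p * c * p) * b'"
      using comm[OF M'(2) that(3)] by (simp add: p')
    have "a' * c * b' = a' * (p * c * p) * b'"
      by (metis p'(2,3) mult.assoc)
    also have "\<dots> = b' * (p * c * p) * a'"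
      by (metis ab ac bc mult.assoc)
    also have "\<dots> = b' * c * a'"
      by (metis p'(1,4) mult.assoc)
    finally show ?thesis
      by (simp add: a'_def b'_def mult.assoc)
  qed
  have approx: "\<exists>c\<in>M. range_approx x n = x * c * star x" for n
  proof (induction n)
    case 0
    show ?case
      by (rule bexI[of _ 0]) (simp_all add: cl)
  next
    case (Suc n)
    then obtain c where c: "c \<in> M" "range_approx x n = x * c * star x"
      by blast
    \<comment> \<open>Here \<open>p\<close> acts as the identity in the middle:
      \<open>x * p * star x = x * star x\<close>.\<close>
    have "range_approx x (Suc n) = x * (c + p - star x * x * c) * star x"
      by (simp add: c algebra_simps px)
    moreover have "c + p - star x * x * c \<in> M"
      by (intro cl c pM xM)
    ultimately show ?case
      by blast
  qed
  \<comment> \<open>The middle factor \<open>l\<close> is the limit of elements of \<open>xMx\<^sup>*\<close>, for which \<open>swap\<close> applies.\<close>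
  have lab: "star x * (a * l * b) * x = star x * (b * l * a) * x" if ab: "a \<in> M" "b \<in> M" for a b
  proof (rule bop_eqI)
    fix v
    let ?k = "range_approx x"
    have lim: "(\<lambda>n. bop_apply (star x * a) (bop_apply (?k n) (bop_apply (b * x) v))) \<longlonglongrightarrow>
        bop_apply (star x * a) (bop_apply l (bop_apply (b * x) v))" for a b
      by (intro tendsto_bop_apply tendsto_range_approx[OF _ l]) (simp add: x)
    have "star x * a * ?k n * b * x = star x * b * ?k n * a * x" for n
      using approx[of n] swap[OF ab] by metis
    then have "bop_apply (star x * a) (bop_apply (?k n) (bop_apply (b * x) v)) =
        bop_apply (star x * b) (bop_apply (?k n) (bop_apply (a * x) v))" for n
      by (metis bop_apply_mult)
    then have "bop_apply (star x * a) (bop_apply l (bop_apply (b * x) v)) =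
        bop_apply (star x * b) (bop_apply l (bop_apply (a * x) v))"
      using lim[of a b] lim[of b a] by (simp add: LIMSEQ_unique)
    then show "bop_apply (star x * (a * l * b) * x) v = bop_apply (star x * (b * l * a) * x) v"
      by simp
  qed
  have "l * (a * l * b) * l = l * (b * l * a) * l" if ab: "a \<in> M" "b \<in> M" for a b
  proof -
    \<comment> \<open>The outer factors \<open>star x\<close> and \<open>x\<close> are traded for
      \<open>l\<close> one side at a time, by \<open>left_support\<close> before and after taking
      adjoints.\<close>
    define D where "D = a * l * b - b * l * a"
    have sl: "star l = l"
      using lP by (simp add: projection_def)
    have "star x * (D * x) = 0"
      using lab[OF ab] by (simp add: D_def algebra_simps)
    then have "l * (D * x) = 0"
      by (rule left_support(2)[OF l])
    from arg_cong[OF this, of star] have "star x * (star D * l) = 0"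
      by (simp add: star_mult sl mult.assoc)
    then have "l * (star D * l) = 0"
      by (rule left_support(2)[OF l])
    from arg_cong[OF this, of star] have "l * D * l = 0"
      by (simp add: star_mult star_star sl mult.assoc)
    then show ?thesis
      by (simp add: D_def algebra_simps)
  qed
  then have "(l * a * l) * (l * b * l) = (l * b * l) * (l * a * l)" if "a \<in> M" "b \<in> M" for a b
    using that projectionD(3)[OF lP] by (simp add: mult.assoc)
  then have "abelian_projection M l"
    using lM lP by (simp add: abelian_projection_def)
  then show thesis
    using that \<open>l \<noteq> 0\<close> zl by blast
qed

text \<open>For a projection \<open>r \<le> q\<close> this says that the central support of \<open>r\<close> in \<open>qMq\<close> is \<open>q\<close>.\<close>

definition full_in :: "'a :: cstar_algebra set \<Rightarrow> 'a \<Rightarrow> 'a \<Rightarrow> bool" where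
  "full_in M q r \<longleftrightarrow> (\<forall>z\<in>M. projection z \<and> q * z = z \<and> (\<forall>y\<in>M. z * y * r = 0) \<longrightarrow> z = 0)"

text \<open>Since distinct members of \<open>G\<close> are not linked by \<open>M\<close>, products
  in \<open>R M R\<close> can be computed inside each commutative corner \<open>g M g\<close>
  separately, so the sum \<open>R\<close> is abelian. If \<open>R\<close> were not full, an abelian
  projection orthogonal to it in this strong sense could be added to \<open>G\<close>.\<close>

lemma ex_full_abelian_projection:
  fixes M :: "'h :: complex_hilbert_space bop set"
  assumes M: "von_neumann_algebra M" and I: "type_I M" and q: "q \<in> M" "projection q"
  obtains r where "abelian_projection M r" "q * r = r" "full_in M q r"
proof -
  note cl = von_neumann_algebra_closed[OF M]
  obtain G where ab: "\<forall>g\<in>G. abelian_projection M g \<and> q * g = g"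
    and pw: "\<forall>g\<in>G. \<forall>h\<in>G. g \<noteq> h \<longrightarrow> (\<forall>y\<in>M. g * y * h = 0)"
    and max: "\<forall>x. (abelian_projection M x \<and> q * x = x) \<and>
      (\<forall>g\<in>G. (\<forall>y\<in>M. x * y * g = 0) \<and> (\<forall>y\<in>M. g * y * x = 0)) \<longrightarrow> x \<in> G"
    using ex_maximal_clique[of "\<lambda>g. abelian_projection M g \<and> q * g = g"
      "\<lambda>g h. \<forall>y\<in>M. g * y * h = 0"] by (elim exE conjE)
  have g: "g \<in> M" "star g = g" "g * g = g" "q * g = g" if "g \<in> G" for g
    using bspec[OF ab that] by (auto simp: abelian_projection_def projection_def)
  have gg: "(g * x * g) * (g * y * g) = (g * y * g) * (g * x * g)"
    if "g \<in> G" "x \<in> M" "y \<in> M" for g x y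
    using bspec[OF ab that(1)] that by (auto simp: abelian_projection_def)
  have gh: "g * y * h = 0" if "g \<in> G" "h \<in> G" "g \<noteq> h" "y \<in> M" for g h y
    using pw that by blast
  have gh0: "g * h = 0" if "g \<in> G" "h \<in> G" "g \<noteq> h" for g h
    using gh[OF that g(1)[OF that(1)]] g(3)[OF that(1)] by simp
  have qs: "star q = q" "q * q = q"
    using q by (auto simp: projection_def)
  have gq: "g * q = g" if "g \<in> G" for g
    using arg_cong[OF g(4)[OF that], of star] by (simp add: star_mult g(2)[OF that] qs)
  obtain R where R: "join_support G R"
    by (rule ex_join_support)
  have RM: "R \<in> M"
    by (rule join_support_in[OF M _ R]) (use g in blast)
  have Rs: "star R = R" "R * R = R"
    using join_supportD(1)[OF R] by (auto simp: projection_def)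
  have qR: "q * R = R"
    by (rule join_support_below[OF R gq qs(1)])
  have gR: "g * R = g" if "g \<in> G" for g
    using join_supportD(2)[OF R that] .
  have Rg: "R * g = g" if "g \<in> G" for g
    using arg_cong[OF gR[OF that], of star] by (simp add: star_mult g[OF that] Rs)
  have Rxg: "R * x * g = g * x * g" if gG: "g \<in> G" and x: "x \<in> M" for g x
  proof -
    have "R * (x * g - g * x * g) = 0"
    proof (rule join_support_annihilates[OF R])
      fix h assume h: "h \<in> G"
      show "h * (x * g - g * x * g) = 0"
      proof (cases "h = g")
        case True
        then show ?thesis
          using g(3)[OF gG] by (simp add: ring_distribs mult.assoc[symmetric])
      next
        case False
        then show ?thesis
          using gh[OF h gG False x] gh0[OF h gG False]
          by (simp add: right_diff_distrib mult.assoc[symmetric])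
      qed
    qed
    then show ?thesis
      using Rg[OF gG] by (simp add: right_diff_distrib mult.assoc[symmetric])
  qed
  have gxR: "g * x * R = g * x * g" if gG: "g \<in> G" and x: "x \<in> M" for g x
    using arg_cong[OF Rxg[OF gG cl(6)[OF x]], of star]
    by (simp add: star_mult star_star g[OF gG] Rs mult.assoc)
  have "(R * x * R) * (R * y * R) = (R * y * R) * (R * x * R)" if xy: "x \<in> M" "y \<in> M" for x y
  proof -
    have form: "g * ((R * x * R) * (R * y * R)) = (g * x * g) * (g * y * g)"
      if "g \<in> G" "x \<in> M" "y \<in> M" for g x y
    proof -
      have "g * ((R * x * R) * (R * y * R)) = (g * x * R) * (y * R)"
        using gR[OF that(1)] Rs by (metis mult.assoc)
      also have "\<dots> = g * x * (g * y * R)"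
        unfolding gxR[OF that(1,2)] by (simp add: mult.assoc)
      also have "\<dots> = g * x * (g * y * g)"
        unfolding gxR[OF that(1,3)] ..
      also have "\<dots> = (g * x * g) * (g * y * g)"
        by (metis g(3)[OF that(1)] mult.assoc)
      finally show ?thesis .
    qed
    define D where "D = (R * x * R) * (R * y * R) - (R * y * R) * (R * x * R)"
    have "R * D = 0"
    proof (rule join_support_annihilates[OF R])
      fix g assume gG: "g \<in> G"
      show "g * D = 0"
        unfolding D_def right_diff_distrib form[OF gG xy] form[OF gG xy(2,1)] gg[OF gG xy] by simp
    qed
    moreover have "R * D = D"
      by (simp add: D_def right_diff_distrib mult.assoc[symmetric] Rs)
    ultimately show ?thesis
      by (simp add: D_def)
  qed
  then have "abelian_projection M R"
    using RM join_supportD(1)[OF R] by (simp add: abelian_projection_def)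
  moreover have "full_in M q R"
    unfolding full_in_def
  proof (intro ballI impI)
    fix z assume zM: "z \<in> M" and "projection z \<and> q * z = z \<and> (\<forall>y\<in>M. z * y * R = 0)"
    then have z: "projection z" "q * z = z" "\<And>y. y \<in> M \<Longrightarrow> z * y * R = 0"
      by auto
    show "z = 0"
    proof (rule ccontr)
      assume "z \<noteq> 0"
      then obtain l where l: "abelian_projection M l" "l \<noteq> 0" "z * l = l"
        using ex_abelian_projection_below[OF M I zM z(1)] by blast
      have lM: "l \<in> M" "star l = l" "l * l = l"
        using l by (auto simp: abelian_projection_def projection_def)
      have lz: "l * z = l"
        using arg_cong[OF l(3), of star] z(1) by (simp add: star_mult lM projection_def)
      \<comment> \<open>From \<open>l * z = l\<close> and \<open>R * g = g\<close> this product
        contains the factor \<open>z * y * R = 0\<close>. So \<open>l\<close> is compatible with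
        \<open>G\<close> and belongs to it, whence \<open>l * R = l\<close>, against
        \<open>z * l * R = 0\<close>.\<close>
      have lyg: "l * y * g = 0" if "y \<in> M" "g \<in> G" for y g
      proof -
        have "l * y * g = l * (z * y * R) * g"
          using lz Rg[OF that(2)] by (metis mult.assoc)
        then show ?thesis
          using z(3)[OF that(1)] by simp
      qed
      have gyl: "g * y * l = 0" if "y \<in> M" "g \<in> G" for y g
        using arg_cong[OF lyg[OF cl(6)[OF that(1)] that(2)], of star]
        by (simp add: star_mult star_star lM g[OF that(2)] mult.assoc)
      have "q * l = l"
        using z(2) l(3) by (metis mult.assoc)
      then have "l \<in> G"
        using l(1) lyg gyl max by auto
      then have "l * l * R = l"
        using lM gR by simp
      moreover have "l * l * R = 0"
        using z(3)[OF lM(1)] lz lM by (metis l(3) mult.assoc)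
      ultimately show False
        using l(2) by simp
    qed
  qed
  ultimately show thesis
    using that qR by blast
qed

section \<open>Jordan ideals of a corner\<close>

text \<open>Closure under limits of bounded nets in the strong operator topology. Nets are represented by
  filters on the operators themselves, so that one hypothesis covers all index types.\<close>

definition boundedly_closed_in :: "'h :: complex_hilbert_space bop set \<Rightarrow> 'h bop set \<Rightarrow> bool" where
  "boundedly_closed_in A J \<longleftrightarrow> (\<forall>C N a. N \<noteq> bot \<and> eventually (\<lambda>x. x \<in> J \<and> norm x \<le> C) N \<and>
     (\<forall>v. ((\<lambda>x. bop_apply x v) \<longlongrightarrow> bop_apply a v) N) \<and> a \<in> A \<longrightarrow> a \<in> J)"

lemma boundedly_closed_inD:
  assumes J: "boundedly_closed_in A J" and N: "N \<noteq> bot"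
    and ev: "eventually (\<lambda>i. X i \<in> J \<and> norm (X i) \<le> C) N"
    and lim: "\<And>v. ((\<lambda>i. bop_apply (X i) v) \<longlongrightarrow> bop_apply a v) N" and a: "a \<in> A"
  shows "a \<in> J"
proof -
  have "filtermap X N \<noteq> bot \<and> eventually (\<lambda>x. x \<in> J \<and> norm x \<le> C) (filtermap X N) \<and>
      (\<forall>v. ((\<lambda>x. bop_apply x v) \<longlongrightarrow> bop_apply a v) (filtermap X N)) \<and> a \<in> A"
    using N ev lim a by (simp add: filtermap_bot_iff eventually_filtermap filterlim_filtermap)
  then show ?thesis
    using J unfolding boundedly_closed_in_def by blast
qed

definition corner :: "'a :: cstar_algebra set \<Rightarrow> 'a \<Rightarrow> 'a set" where
  "corner M q = {x \<in> M. q * x = x \<and> x * q = x}"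

lemma corner_closed:
  assumes M: "von_neumann_algebra M" and q: "star q = q"
  shows "0 \<in> corner M q" "x \<in> corner M q \<Longrightarrow> y \<in> corner M q \<Longrightarrow> x + y \<in> corner M q"
    "x \<in> corner M q \<Longrightarrow> y \<in> corner M q \<Longrightarrow> x - y \<in> corner M q"
    "x \<in> corner M q \<Longrightarrow> y \<in> corner M q \<Longrightarrow> x * y \<in> corner M q"
    "x \<in> corner M q \<Longrightarrow> c *\<^sub>R x \<in> corner M q"
    "x \<in> corner M q \<Longrightarrow> d *\<^sub>C x \<in> corner M q"
    "x \<in> corner M q \<Longrightarrow> star x \<in> corner M q"
proof -
  note cl = von_neumann_algebra_closed[OF M]
  show "0 \<in> corner M q"
    by (simp add: corner_def cl)
  show "x \<in> corner M q \<Longrightarrow> y \<in> corner M q \<Longrightarrow> x + y \<in> corner M q"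
    "x \<in> corner M q \<Longrightarrow> y \<in> corner M q \<Longrightarrow> x - y \<in> corner M q"
    "x \<in> corner M q \<Longrightarrow> c *\<^sub>R x \<in> corner M q"
    by (simp_all add: corner_def cl algebra_simps)
  show "x \<in> corner M q \<Longrightarrow> y \<in> corner M q \<Longrightarrow> x * y \<in> corner M q"
    by (auto simp: corner_def cl mult.assoc[symmetric]) (simp add: mult.assoc)
  show "x \<in> corner M q \<Longrightarrow> d *\<^sub>C x \<in> corner M q"
    using von_neumann_algebraD(1)[OF M]
    by (simp add: corner_def csubspaceD scaleC_mult_left scaleC_mult_right)
  show "star x \<in> corner M q" if x: "x \<in> corner M q"
  proof -
    have "x \<in> M" "q * x = x" "x * q = x"
      using x by (auto simp: corner_def)
    moreover have "q * star x = star (x * q)" "star x * q = star (q * x)"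
      by (simp_all add: star_mult q)
    ultimately show ?thesis
      by (simp add: corner_def cl)
  qed
qed

lemma csubspace_corner:
  assumes "von_neumann_algebra M" "star q = q"
  shows "csubspace (corner M q)"
  using corner_closed[OF assms] by (auto simp: csubspace_def)

text \<open>Let \<open>R\<close> be the supremum of a maximal orthogonal family of projections in
  \<open>J\<close>. If \<open>(q - R) * y * r\<close> were nonzero, its range projection would lie
  in \<open>J\<close> and be orthogonal to the family. So it vanishes for all \<open>y\<close>, and
  fullness of \<open>r\<close> gives \<open>q = R\<close>.\<close>

lemma full_jordan_ideal:
  fixes M :: "'h :: complex_hilbert_space bop set"
  assumes M: "von_neumann_algebra M" and q: "q \<in> M" "projection q"
    and J: "J \<subseteq> corner M q" "csubspace J" "boundedly_closed_in (corner M q) J"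
    and jordan: "\<And>x y. x \<in> J \<Longrightarrow> y \<in> corner M q \<Longrightarrow> x * y + y * x \<in> J"
    and r: "r \<in> J" "r * r = r" "star r = r" and full: "full_in M q r"
  shows "q \<in> J"
proof -
  let ?N = "corner M q"
  note cl = von_neumann_algebra_closed[OF M]
  have qs: "star q = q" "q * q = q"
    using q by (auto simp: projection_def)
  note ncl = corner_closed[OF M qs(1)]
  note jcl = csubspaceD[OF J(2)]
  have N: "x \<in> M" "q * x = x" "x * q = x" if "x \<in> ?N" for x
    using that by (auto simp: corner_def)
  have rr: "r * (r * y) = r * y" for y
    by (simp add: r(2) mult.assoc[symmetric])
  have rN: "r \<in> ?N"
    using r J by blast
  have yr: "y * r \<in> J" if y: "y \<in> ?N" for y
  proof -
    \<comment> \<open>As \<open>r\<close> is idempotent, its Jordan product with the commutator \<open>ry - yr\<close> is again that commutator.\<close>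
    have "r * (r * y - y * r) + (r * y - y * r) * r = r * y - y * r"
      by (simp add: ring_distribs r(2) mult.assoc rr)
    then have "r * y - y * r \<in> J"
      using jordan[OF r(1) ncl(3)[OF ncl(4)[OF rN y] ncl(4)[OF y rN]]] by simp
    from jcl(4)[OF jcl(6)[OF jordan[OF r(1) y] this], of "1 / 2"]
    have "(1 / 2) *\<^sub>R ((r * y + y * r) - (r * y - y * r)) \<in> J" .
    moreover have "(r * y + y * r) - (r * y - y * r) = 2 *\<^sub>R (y * r)"
      by (simp add: scaleR_2)
    ultimately show ?thesis
      by simp
  qed
  \<comment> \<open>The Jordan product of \<open>y * r\<close> with \<open>w\<close> has a second
    term \<open>(w * y) * r\<close>, which is in \<open>J\<close> by \<open>yr\<close> and can be
    subtracted.\<close>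
  have yrw: "y * r * w \<in> J" if y: "y \<in> ?N" and w: "w \<in> ?N" for y w
  proof -
    have "(y * r * w + w * (y * r)) - w * y * r \<in> J"
      by (rule jcl(6)[OF jordan[OF yr[OF y] w] yr[OF ncl(4)[OF w y]]])
    then show ?thesis
      by (simp add: mult.assoc)
  qed
  obtain G where G: "\<forall>g\<in>G. g \<in> J \<and> projection g"
    and pw: "\<forall>g\<in>G. \<forall>h\<in>G. g \<noteq> h \<longrightarrow> g * h = 0"
    and max: "\<forall>x. (x \<in> J \<and> projection x) \<and> (\<forall>g\<in>G. x * g = 0 \<and> g * x = 0) \<longrightarrow> x \<in> G"
    using ex_maximal_clique[of "\<lambda>g. g \<in> J \<and> projection g" "\<lambda>g h. g * h = 0"] by (elim exE conjE)
  have GJ: "G \<subseteq> J" and Go: "orthogonal_projections G"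
    using G pw by (auto simp: orthogonal_projections_def)
  have GN: "g \<in> ?N" if "g \<in> G" for g
    using GJ J(1) that by blast
  obtain R where R: "join_support G R"
    by (rule ex_join_support)
  have RM: "R \<in> M"
    by (rule join_support_in[OF M _ R]) (use GN N in blast)
  have Rs: "star R = R" "R * R = R"
    using join_supportD(1)[OF R] by (auto simp: projection_def)
  have Rq: "R * q = R" "q * R = R"
    using join_support_below[OF R N(3)[OF GN] qs(1)] by auto
  have RN: "R \<in> ?N"
    by (simp add: corner_def RM Rq)
  have RJ: "R \<in> J"
  proof (rule boundedly_closed_inD[OF J(3) _ _ tendsto_sum_projections[OF Go R] RN])
    show "finite_subsets_at_top G \<noteq> bot"
      by simp
    have sumJ: "\<Sum>F \<in> J" if "finite F" "F \<subseteq> J" for F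
      using that by (induction F) (auto intro: jcl)
    have "norm (\<Sum>F) \<le> 1" if "finite F" "F \<subseteq> G" for F
    proof -
      have "orthogonal_projections F"
        using Go that(2) by (auto simp: orthogonal_projections_def)
      then show ?thesis
        using that(1) by (simp add: norm_projection_le projection_sum)
    qed
    then show "eventually (\<lambda>F. \<Sum>F \<in> J \<and> norm (\<Sum>F) \<le> 1) (finite_subsets_at_top G)"
      using GJ by (intro eventually_finite_subsets_at_top_weakI conjI sumJ) auto
  qed
  have vanish: "(q - R) * y * r = 0" if y: "y \<in> M" for y
  proof (rule ccontr)
    assume nz: "(q - R) * y * r \<noteq> 0"
    \<comment> \<open>The factor \<open>q\<close> after \<open>y\<close> puts \<open>w\<close> in
      the corner; it disappears in \<open>w * r\<close> because \<open>q * r = r\<close>.\<close>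
    define w where "w = (1 / norm ((q - R) * y * r)) *\<^sub>R ((q - R) * (y * q))"
    have "(q - R) * (y * q) \<in> ?N"
      using cl(3)[OF q(1) RM] y q(1)
      by (simp add: corner_def cl) (simp add: ring_distribs qs Rq mult.assoc[symmetric], simp add: mult.assoc qs)
    then have wN: "w \<in> ?N"
      unfolding w_def by (rule ncl)
    define x where "x = w * r"
    have x: "x = (1 / norm ((q - R) * y * r)) *\<^sub>R ((q - R) * y * r)"
      by (simp add: x_def w_def mult.assoc N[OF rN])
    have x1: "norm x = 1"
      using nz by (simp add: x)
    have xN: "x \<in> ?N"
      unfolding x_def by (intro ncl wN rN)
    \<comment> \<open>With \<open>r\<close> idempotent and self-adjoint, each increment of
      \<open>range_approx\<close> has the form handled by \<open>yrw\<close>.\<close>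
    have xx: "x * star x * k = w * r * (star w * k)" for k
      by (simp add: x_def star_mult r mult.assoc) (simp add: r mult.assoc[symmetric])
    have xx': "x * star x = w * r * star w"
      by (simp add: x_def star_mult r mult.assoc) (simp add: r mult.assoc[symmetric])
    have kJ: "range_approx x n \<in> J" for n
    proof (induction n)
      case (Suc n)
      then have "x * star x * range_approx x n \<in> J"
        unfolding xx using J(1) by (intro yrw wN ncl) auto
      moreover have "x * star x \<in> J"
        unfolding xx' by (intro yrw wN ncl)
      ultimately show ?case
        unfolding range_approx.simps by (intro jcl(6) jcl(2) Suc)
    qed (simp add: jcl)
    obtain l where l: "join_support {star x} l"
      by (rule ex_join_support)
    have sxq: "star x * q = star x"
      using ncl(7)[OF xN] by (simp add: corner_def)
    have lM: "l \<in> M"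
      by (rule join_support_in[OF M _ l]) (use N(1)[OF xN] cl in simp)
    have "l * q = l" "q * l = l"
      using join_support_below[OF l _ qs(1)] sxq by auto
    then have lN: "l \<in> ?N"
      using lM by (simp add: corner_def)
    have lJ: "l \<in> J"
    proof (rule boundedly_closed_inD[OF J(3) _ _ _ lN])
      show "(\<lambda>n. bop_apply (range_approx x n) v) \<longlonglongrightarrow> bop_apply l v" for v
        by (rule tendsto_range_approx[OF _ l]) (simp add: x1)
      show "eventually (\<lambda>n. range_approx x n \<in> J \<and> norm (range_approx x n) \<le> 2) sequentially"
        using kJ norm_range_approx[OF _ l] x1 by (intro always_eventually) simp
    qed simp
    have "R * x = 0"
      by (simp add: x ring_distribs mult.assoc[symmetric] Rq Rs)
    from arg_cong[OF this, of star] have "star x * R = 0"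
      by (simp add: star_mult Rs)
    then have lR: "l * R = 0"
      by (rule left_support(2)[OF l])
    have lP: "projection l"
      by (rule join_supportD(1)[OF l])
    have Rg: "g * R = g" "R * g = g" "projection g" if g: "g \<in> G" for g
    proof -
      show "projection g"
        using Go g by (simp add: orthogonal_projections_def)
      show "g * R = g"
        by (rule join_supportD(2)[OF R g])
      from arg_cong[OF this, of star] show "R * g = g"
        using \<open>projection g\<close> by (simp add: star_mult Rs projection_def)
    qed
    have lg: "l * g = 0" if "g \<in> G" for g
      using lR Rg(2)[OF that] by (metis mult.assoc mult_zero_left)
    have gl: "g * l = 0" if "g \<in> G" for g
      using arg_cong[OF lg[OF that], of star] lP Rg(3)[OF that] by (simp add: star_mult projection_def)
    have "l \<in> G"
      using lJ lP lg gl max by auto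
    then have "l = 0"
      using lR Rg(1) by metis
    then show False
      using left_support(1)[OF l] x1 by auto
  qed
  have "q - R \<in> M" "projection (q - R)" "q * (q - R) = q - R"
    using cl(3)[OF q(1) RM] by (simp_all add: projection_def star_diff algebra_simps qs Rs Rq)
  with full vanish have "q - R = 0"
    unfolding full_in_def by blast
  then show ?thesis
    using RJ by simp
qed

section \<open>The Peirce 2-space\<close>

text \<open>By the C*-identity it suffices that the square \<open>star d * d\<close> of the
  difference \<open>d = e - e * star e * e\<close> vanishes, and this expands into powers of the
  projection \<open>star e * e\<close>.\<close>

lemma partial_isometryD:
  assumes "partial_isometry e"
  shows "e * star e * e = e"
proof -
  let ?q = "star e * e"
  have q: "star ?q = ?q" "?q * ?q = ?q"
    using assms by (auto simp: partial_isometry_def projection_def)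
  have "star (e - e * ?q) * (e - e * ?q) = (?q - ?q * ?q) - (?q * ?q - ?q * ?q * ?q)"
    using q(1) by (simp add: star_diff star_mult star_star ring_distribs mult.assoc)
  then have "star (e - e * ?q) * (e - e * ?q) = 0"
    by (simp add: q)
  then have "norm (e - e * ?q) = 0"
    using norm_star_mult[of "e - e * ?q"] by simp
  then show ?thesis
    by (simp add: mult.assoc)
qed

lemma partial_isometry_simps:
  assumes "partial_isometry e"
  shows "e * (star e * e) = e" "star e * (e * star e) = star e"
    "e * (star e * (e * w)) = e * w" "star e * (e * (star e * w)) = star e * w"
proof -
  show 1: "e * (star e * e) = e"
    using partial_isometryD[OF assms] by (simp add: mult.assoc)
  from arg_cong[OF 1, of star] show 2: "star e * (e * star e) = star e"
    by (simp add: star_mult star_star mult.assoc)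
  show "e * (star e * (e * w)) = e * w" "star e * (e * (star e * w)) = star e * w"
    using arg_cong[OF 1, of "\<lambda>x. x * w"] arg_cong[OF 2, of "\<lambda>x. x * w"] by (simp_all add: mult.assoc)
qed

lemma norm_partial_isometry_le:
  assumes "partial_isometry e"
  shows "norm e \<le> 1"
proof -
  have "(norm e)\<^sup>2 \<le> 1"
    using norm_projection_le[of "star e * e"] assms by (simp add: partial_isometry_def norm_star_mult)
  then show ?thesis
    by (simp add: abs_square_le_1)
qed

lemma peirce2_proj_eq: "peirce2_proj e x = e * star e * x * star e * e"
  by (simp add: peirce2_proj_def cstar_triple_def star_mult star_star mult.assoc flip: scaleR_2)

lemma peirce2_eq:
  assumes M: "von_neumann_algebra M" and e: "e \<in> M" "partial_isometry e"
  shows "peirce2 e M = {x \<in> M. e * star e * x = x \<and> x * star e * e = x}"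
proof (intro equalityI subsetI)
  note cl = von_neumann_algebra_closed[OF M]
  fix x
  show "x \<in> {x \<in> M. e * star e * x = x \<and> x * star e * e = x}" if x: "x \<in> peirce2 e M"
  proof -
    obtain y where y: "y \<in> M" "x = e * star e * y * star e * e"
      using x by (auto simp: peirce2_def peirce2_proj_eq)
    have "x \<in> M"
      unfolding y by (intro cl e y)
    moreover have "e * star e * x = x"
      by (simp add: y mult.assoc partial_isometry_simps[OF e(2)])
    moreover have "x * star e * e = x"
      by (simp add: y mult.assoc partial_isometry_simps[OF e(2)])
    ultimately show ?thesis
      by simp
  qed
  show "x \<in> peirce2 e M" if "x \<in> {x \<in> M. e * star e * x = x \<and> x * star e * e = x}"
  proof -
    have "x = peirce2_proj e x"
      using that unfolding peirce2_proj_eq by simp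
    then show ?thesis
      unfolding peirce2_def by (rule image_eqI) (use that in simp)
  qed
qed

text \<open>Two nested Jordan products give the factor 1/4. The first two summands contain two mixed
  terms each, and these are exactly the four terms of the third; what remains is twice
  \<open>x * star y * z + z * star y * x\<close>.\<close>

lemma jordan_triple_peirce2:
  assumes "e * star e * e = e"
    and "e * star e * x = x" "x * star e * e = x" "e * star e * y = y" "y * star e * e = y"
    and "e * star e * z = z" "z * star e * e = z"
  shows "jordan_triple (peirce2_prod e) (peirce2_star e) x y z = cstar_triple x y z"
proof -
  have r: "x * (star e * e) = x" "z * (star e * e) = z"
    "x * (star e * (e * w)) = x * w" "z * (star e * (e * w)) = z * w"
    "e * (star e * x) = x" "e * (star e * z) = z"
    "e * (star e * (x * w)) = x * w" "e * (star e * (z * w)) = z * w"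
    "e * (star e * e) = e" "e * (star e * (e * w)) = e * w" for w
    by (simp_all add: mult.assoc[symmetric] assms)
  note expand = peirce2_prod_def peirce2_star_def cstar_triple_def star_mult star_star
    ring_distribs mult.assoc r scaleR_add_right
  have 1: "peirce2_prod e (peirce2_prod e x (peirce2_star e y)) z = (1 / 4) *\<^sub>R
      (x * star y * z + e * star y * x * star e * z + z * star e * x * star y * e + z * star y * x)"
    by (simp add: expand)
  have 2: "peirce2_prod e (peirce2_prod e (peirce2_star e y) z) x = (1 / 4) *\<^sub>R
      (e * star y * z * star e * x + z * star y * x + x * star y * z + x * star e * z * star y * e)"
    by (simp add: expand)
  have 3: "peirce2_prod e (peirce2_prod e z x) (peirce2_star e y) = (1 / 4) *\<^sub>R
      (z * star e * x * star y * e + x * star e * z * star y * e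
        + e * star y * z * star e * x + e * star y * x * star e * z)"
    by (simp add: expand)
  have "jordan_triple (peirce2_prod e) (peirce2_star e) x y z = (1 / 4) *\<^sub>R
      (2 *\<^sub>R (x * star y * z + z * star y * x))"
    unfolding jordan_triple_def 1 2 3 scaleR_add_right[symmetric] scaleR_diff_right[symmetric]
    by (rule arg_cong[where f="\<lambda>a. (1 / 4) *\<^sub>R a"]) (simp add: scaleR_2)
  then show ?thesis
    by (simp add: cstar_triple_def)
qed

section \<open>Preduals of spaces cut out by linear equations\<close>

text \<open>Tested against vectors, each defining equation of \<open>A\<close> says that a vector
  form with two terms vanishes. Hence an operator killed by all forms vanishing on \<open>A\<close>
  satisfies the same equations.\<close>

lemma predual_weakly_defined:
  fixes S :: "'h :: complex_hilbert_space bop set" and p q :: "'h bop"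
  assumes S: "\<And>y. y \<in> S \<Longrightarrow> star y \<in> S"
  defines "A \<equiv> {x \<in> commutant S. p * x = x \<and> x * q = x}"
  assumes A: "csubspace A"
  shows "predual A (normal_functionals A)"
proof (rule predual_normal_functionals[OF A])
  fix a assume a: "\<And>ps. (\<And>x. x \<in> A \<Longrightarrow> vector_form ps x = 0) \<Longrightarrow> vector_form ps a = 0"
  have eq: "b = c" if "\<And>v w. cinner (bop_apply b v) w = cinner (bop_apply c v) w" for b c :: "'h bop"
    by (rule bop_eqI, rule cinner_left_eqI) (rule that)
  have minus: "cinner (- v) w = - cinner v w" for v w :: 'h
    using cinner_diff_left[of 0 v w] by simp
  have minus_right: "bop_apply b (- v) = - bop_apply b v" for b and v :: 'h
    using bop_apply_diff_right[of b 0 v] by simp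
  have "y * a = a * y" if y: "y \<in> S" for y
  proof (rule eq)
    fix v w
    \<comment> \<open>At \<open>x\<close> this form equals the inner product of
      \<open>(x * y - y * x) v\<close> with \<open>w\<close>.\<close>
    have "vector_form [(bop_apply y v, w), (- v, bop_apply (star y) w)] a = 0"
    proof (rule a)
      fix x assume "x \<in> A"
      then have "y * x = x * y"
        using y by (auto simp: A_def commutant_def)
      then have "bop_apply y (bop_apply x v) = bop_apply x (bop_apply y v)"
        by (metis bop_apply_mult)
      then show "vector_form [(bop_apply y v, w), (- v, bop_apply (star y) w)] x = 0"
        by (simp add: vector_form_simps minus minus_right cinner_star[symmetric])
    qed
    then show "cinner (bop_apply (y * a) v) w = cinner (bop_apply (a * y) v) w"
      by (simp add: vector_form_simps minus minus_right cinner_star[symmetric])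
  qed
  moreover have "p * a = a"
  proof (rule eq)
    fix v w
    have "vector_form [(v, bop_apply (star p) w), (- v, w)] a = 0"
    proof (rule a)
      fix x assume "x \<in> A"
      then have "bop_apply p (bop_apply x v) = bop_apply x v"
        unfolding A_def by (metis (mono_tags, lifting) bop_apply_mult mem_Collect_eq)
      then show "vector_form [(v, bop_apply (star p) w), (- v, w)] x = 0"
        by (simp add: vector_form_simps minus minus_right cinner_star[symmetric])
    qed
    then show "cinner (bop_apply (p * a) v) w = cinner (bop_apply a v) w"
      by (simp add: vector_form_simps minus minus_right cinner_star[symmetric])
  qed
  moreover have "a * q = a"
  proof (rule eq)
    fix v w
    have "vector_form [(bop_apply q v, w), (- v, w)] a = 0"
    proof (rule a)
      fix x assume "x \<in> A"
      then have "bop_apply x (bop_apply q v) = bop_apply x v"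
        unfolding A_def by (metis (mono_tags, lifting) bop_apply_mult mem_Collect_eq)
      then show "vector_form [(bop_apply q v, w), (- v, w)] x = 0"
        by (simp add: vector_form_simps minus minus_right)
    qed
    then show "cinner (bop_apply (a * q) v) w = cinner (bop_apply a v) w"
      by (simp add: vector_form_simps minus minus_right)
  qed
  ultimately show "a \<in> A"
    by (simp add: A_def commutant_def)
qed

text \<open>Separate left and right factors let one statement serve both the Peirce space, with
  \<open>e * star e\<close> on the left and \<open>star e * e\<close> on the right, and the
  corner.\<close>

lemma
  fixes M :: "'h :: complex_hilbert_space bop set" and p q :: "'h bop"
  assumes M: "von_neumann_algebra M"
  defines "A \<equiv> {x \<in> M. p * x = x \<and> x * q = x}"
  shows csubspace_peirce: "csubspace A"
    and predual_peirce_normal: "predual A (normal_functionals A)"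
proof -
  show A: "csubspace A"
    using von_neumann_algebraD(1)[OF M] von_neumann_algebra_closed[OF M]
    by (auto simp: csubspace_def A_def ring_distribs scaleC_mult_left scaleC_mult_right)
  have "M = commutant (commutant M)"
    using von_neumann_algebraD(4)[OF M] by simp
  then have "A = {x \<in> commutant (commutant M). p * x = x \<and> x * q = x}"
    unfolding A_def by simp
  with A show "predual A (normal_functionals A)"
    using predual_weakly_defined[of "commutant M" p q] commutant_star[OF von_neumann_algebraD(3)[OF M]]
    by simp
qed

lemma closed_corner:
  fixes M :: "'h :: complex_hilbert_space bop set"
  assumes M: "von_neumann_algebra M"
  shows "closed (corner M q)"
proof -
  have "M = (\<Inter>y\<in>commutant M. {x. y * x = x * y})"
    using von_neumann_algebraD(4)[OF M] by (auto simp: commutant_def)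
  moreover have "closed {x :: 'h bop. y * x = x * y}" for y
    by (intro closed_Collect_eq continuous_intros)
  ultimately have "closed M"
    by (metis (no_types, lifting) closed_INT)
  moreover have "closed {x :: 'h bop. q * x = x}" "closed {x :: 'h bop. x * q = x}"
    by (intro closed_Collect_eq continuous_intros)+
  moreover have "corner M q = M \<inter> ({x. q * x = x} \<inter> {x. x * q = x})"
    by (auto simp: corner_def)
  ultimately show ?thesis
    by (simp add: closed_Int)
qed

theorem proposition3p1:
  fixes M :: "'h :: complex_hilbert_space bop set" and e :: "'h bop"
  assumes "von_neumann_algebra M"
    and "type_I M"
    and "e \<in> M"
    and "partial_isometry e"
  shows "type_I_JW_star_algebra TYPE('h bop) (peirce2 e M) (peirce2_prod e) (peirce2_star e)"
proof -
  note M = assms(1) and I = assms(2) and eM = assms(3) and pe = assms(4)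
  note cl = von_neumann_algebra_closed[OF M]
  define q where "q = star e * e"
  let ?A = "peirce2 e M" and ?N = "corner M q"
  let ?F = "normal_functionals ?A"
  let ?tp = "jordan_triple (peirce2_prod e) (peirce2_star e)"
  have A: "?A = {x \<in> M. e * star e * x = x \<and> x * q = x}"
    using peirce2_eq[OF M eM pe] by (simp add: q_def mult.assoc)
  have ee: "e * star e * e = e"
    by (rule partial_isometryD[OF pe])
  have see: "star e * e * star e = star e"
    using partial_isometry_simps(2)[OF pe] by (simp add: mult.assoc)
  have eq: "e * q = e" "q * star e = star e"
    using ee see by (simp_all add: q_def mult.assoc)
  have qM: "q \<in> M"
    unfolding q_def by (intro cl eM)
  have qP: "projection q"
    using pe by (simp add: partial_isometry_def q_def)
  then have qs: "star q = q" "q * q = q"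
    by (auto simp: projection_def)
  note ncl = corner_closed[OF M qs(1)]
  have AM: "x \<in> M" "e * star e * x = x" "x * q = x" "x * star e * e = x" "e * (star e * x) = x" if "x \<in> ?A" for x
    using that A by (auto simp: q_def mult.assoc)
  have NM: "x \<in> M" "q * x = x" "x * q = x" "x * star e * e = x" if "x \<in> ?N" for x
    using that by (auto simp: corner_def q_def mult.assoc)
  have csA: "csubspace ?A"
    unfolding A by (rule csubspace_peirce[OF M])
  have predA: "predual ?A ?F"
    unfolding A by (rule predual_peirce_normal[OF M])
  have eA: "e \<in> ?A"
    using eM ee eq by (simp add: A)
  have to_N: "star e * x \<in> ?N" if "x \<in> ?A" for x
    unfolding corner_def mem_Collect_eq
  proof (intro conjI)
    show "star e * x \<in> M"
      by (intro cl eM AM(1)[OF that])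
    show "q * (star e * x) = star e * x"
      using eq(2) by (metis mult.assoc)
    show "star e * x * q = star e * x"
      using AM(3)[OF that] by (metis mult.assoc)
  qed
  have to_A: "e * x \<in> ?A" if "x \<in> ?N" for x
    unfolding A mem_Collect_eq
  proof (intro conjI)
    show "e * x \<in> M"
      by (intro cl eM NM(1)[OF that])
    show "e * star e * (e * x) = e * x"
      using ee by (metis mult.assoc)
    show "e * x * q = e * x"
      using NM(3)[OF that] by (metis mult.assoc)
  qed
  have tp: "?tp x y z = cstar_triple x y z" if "x \<in> ?A" "y \<in> ?A" "z \<in> ?A" for x y z
    by (rule jordan_triple_peirce2[OF ee]) (use AM that in blast)+
  have prod: "peirce2_prod e x y \<in> ?A" if x: "x \<in> ?A" and y: "y \<in> ?A" for x y
  proof -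
    have "a * star e * b \<in> ?A" if a: "a \<in> ?A" and b: "b \<in> ?A" for a b
      unfolding A mem_Collect_eq
    proof (intro conjI)
      show "a * star e * b \<in> M"
        by (intro cl eM AM(1)[OF a] AM(1)[OF b])
      show "e * star e * (a * star e * b) = a * star e * b"
        using AM(2)[OF a] by (metis mult.assoc)
      show "a * star e * b * q = a * star e * b"
        using AM(3)[OF b] by (metis mult.assoc)
    qed
    from this[OF x y] this[OF y x] show ?thesis
      unfolding peirce2_prod_def cstar_triple_def by (intro csubspaceD[OF csA])
  qed
  have sharp: "peirce2_star e x \<in> ?A" if x: "x \<in> ?A" for x
    unfolding A mem_Collect_eq peirce2_star_def
  proof (intro conjI)
    show "e * star x * e \<in> M"
      by (intro cl eM AM(1)[OF x])
    show "e * star e * (e * star x * e) = e * star x * e"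
      using ee by (metis mult.assoc)
    show "e * star x * e * q = e * star x * e"
      using eq(1) by (metis mult.assoc)
  qed
  have JW: "JW_star_algebra TYPE('h bop) ?A (peirce2_prod e) (peirce2_star e)"
    unfolding JW_star_algebra_def
  proof (intro conjI ballI exI[of _ ?N] exI[of _ "\<lambda>x. star e * x"] allI)
    show "csubspace ?A" by (rule csA)
    show "peirce2_prod e x y \<in> ?A" if "x \<in> ?A" "y \<in> ?A" for x y by (rule prod[OF that])
    show "peirce2_star e x \<in> ?A" if "x \<in> ?A" for x by (rule sharp[OF that])
    show "csubspace ?N" by (rule csubspace_corner[OF M qs(1)])
    show "closed ?N" by (rule closed_corner[OF M])
    show "star x \<in> ?N" if "x \<in> ?N" for x by (rule ncl(7)[OF that])
    show "(1 / 2) *\<^sub>R (x * y + y * x) \<in> ?N" if "x \<in> ?N" "y \<in> ?N" for x y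
      using that by (intro ncl)
    show "dual_banach_space ?N"
      unfolding dual_banach_space_def corner_def
      by (intro conjI exI) (rule csubspace_peirce[OF M], rule predual_peirce_normal[OF M])
    show "bij_betw (\<lambda>x. star e * x) ?A ?N"
    proof (rule bij_betwI[where g="\<lambda>x. e * x"])
      show "star e * (e * x) = x" if "x \<in> ?N" for x
        using NM(2)[OF that] by (simp add: q_def mult.assoc)
    qed (use to_N to_A AM(5) in auto)
    show "star e * (x + y) = star e * x + star e * y" for x y
      by (rule distrib_left)
    show "star e * (c *\<^sub>C x) = c *\<^sub>C (star e * x)" for c x
      by (rule scaleC_mult_right)
    \<comment> \<open>Multiplication by \<open>star e\<close> and its inverse, multiplication by
      \<open>e\<close>, are both contractions.\<close>
    show "norm (star e * x) = norm x" if x: "x \<in> ?A" for x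
    proof (rule antisym)
      have le: "norm (a * b) \<le> norm b" if "norm a \<le> 1" for a b :: "'h bop"
        using norm_mult_ineq[of a b] mult_right_mono[OF that norm_ge_zero[of b]] by simp
      show "norm (star e * x) \<le> norm x"
        by (rule le) (simp add: norm_partial_isometry_le[OF pe])
      show "norm x \<le> norm (star e * x)"
        using le[OF norm_partial_isometry_le[OF pe], of "star e * x"] AM(5)[OF x] by simp
    qed
    show "star e * peirce2_prod e x y = (1 / 2) *\<^sub>R (star e * x * (star e * y) + star e * y * (star e * x))" for x y
      by (simp add: peirce2_prod_def cstar_triple_def ring_distribs mult.assoc)
    show "star e * peirce2_star e x = star (star e * x)" if x: "x \<in> ?A" for x
      using arg_cong[OF AM(3)[OF x], of star]
      by (simp add: peirce2_star_def star_mult star_star qs) (simp add: q_def mult.assoc[symmetric])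
  qed
  obtain r where r: "abelian_projection M r" "q * r = r" "full_in M q r"
    by (rule ex_full_abelian_projection[OF M I qM qP])
  have rM: "r \<in> M" "star r = r" "r * r = r"
    using r by (auto simp: abelian_projection_def projection_def)
  have rq: "r * q = r"
    using arg_cong[OF r(2), of star] by (simp add: star_mult rM qs)
  have rN: "r \<in> ?N"
    by (simp add: corner_def rM r rq)
  define u where "u = e * r"
  have uA: "u \<in> ?A"
    unfolding u_def by (rule to_A[OF rN])
  have su: "star u * u = r"
    using r(2) rM by (simp add: u_def q_def star_mult mult.assoc)
  have ur: "u * r = u"
    by (simp add: u_def mult.assoc rM)
  have su2: "star u * (u * w) = r * w" and ur2: "u * (r * w) = u * w" for w
    by (simp_all add: su ur mult.assoc[symmetric])
  have u3: "cstar_triple u u u = u"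
    by (simp add: cstar_triple_def mult.assoc su ur flip: scaleR_2)
  have tripotent: "tripotent ?tp u"
    by (simp add: tripotent_def tp[OF uA uA uA] u3)
  have abelian: "abelian_tripotent ?A ?tp u"
  proof -
    define P where "P = (\<lambda>x. ?tp u (?tp u x u) u) ` ?A"
    have uxu: "cstar_triple u x u = u * star x * u" for x
      by (simp add: cstar_triple_def flip: scaleR_2)
    have tpA: "?tp x y z \<in> ?A" if "x \<in> ?A" "y \<in> ?A" "z \<in> ?A" for x y z
      unfolding jordan_triple_def by (intro csubspaceD[OF csA] prod sharp that)
    have uuu: "?tp u (?tp u a u) u = u * star u * a * r" if a: "a \<in> ?A" for a
    proof -
      have outer: "?tp u (?tp u a u) u = u * star (?tp u a u) * u"
        using tp[OF uA tpA[OF uA a uA] uA] uxu by simp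
      have inner: "?tp u a u = u * star a * u"
        using tp[OF uA a uA] uxu by simp
      show ?thesis
        unfolding outer unfolding inner by (simp add: star_mult star_star mult.assoc su)
    qed
    have P: "x \<in> ?A" "u * star u * x = x" "x * r = x" if x: "x \<in> P" for x
    proof -
      obtain a where a: "a \<in> ?A" "x = ?tp u (?tp u a u) u"
        using x by (auto simp: P_def)
      show "x \<in> ?A"
        unfolding a by (intro tpA uA a)
      have "x = u * star u * a * r"
        using uuu[OF a(1)] a(2) by simp
      then show "u * star u * x = x" "x * r = x"
        by (simp_all add: mult.assoc su2 ur2 rM)
    qed
    \<comment> \<open>For \<open>z\<close> in \<open>P\<close> the element \<open>star u * z\<close>
      lies in the commutative algebra \<open>r M r\<close>. Multiplying the resulting commutation
      relation by \<open>u\<close> on the left restores \<open>x\<close> and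
      \<open>y\<close>.\<close>
    have comm: "x * star u * y = y * star u * x" if x: "x \<in> P" and y: "y \<in> P" for x y
    proof -
      have form: "r * (star u * z) * r = star u * z" "star u * z \<in> M" if "z \<in> P" for z
      proof -
        have "r * star u = star u"
          using arg_cong[OF ur, of star] by (simp add: star_mult rM)
        then show "r * (star u * z) * r = star u * z"
          using P(3)[OF that] by (metis mult.assoc)
        show "star u * z \<in> M"
          by (intro cl AM(1)[OF P(1)[OF that]] AM(1)[OF uA])
      qed
      have "(star u * x) * (star u * y) = (star u * y) * (star u * x)"
        using r(1) form[OF x] form[OF y] unfolding abelian_projection_def by metis
      then have "(u * star u * x) * (star u * y) = (u * star u * y) * (star u * x)"
        by (metis mult.assoc)
      then show ?thesis
        unfolding P(2)[OF x] P(2)[OF y] by (simp add: mult.assoc)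
    qed
    \<comment> \<open>Both halves of the triple product now agree, so it is an ordinary operator
      product, and associativity is inherited once \<open>inP\<close> keeps iterated products in
      \<open>P\<close>.\<close>
    have prodP: "?tp x u y = x * star u * y" if "x \<in> P" "y \<in> P" for x y
      using comm[OF that] tp[OF P(1)[OF that(1)] uA P(1)[OF that(2)]]
      by (simp add: cstar_triple_def flip: scaleR_2)
    have inP: "x * star u * y \<in> P" if x: "x \<in> P" and y: "y \<in> P" for x y
    proof -
      have w: "x * star u * y \<in> ?A"
        using prodP[OF x y] tpA[OF P(1)[OF x] uA P(1)[OF y]] by simp
      have "?tp u (?tp u (x * star u * y) u) u = u * star u * (x * star u * y) * r"
        by (rule uuu[OF w])
      also have "\<dots> = x * star u * y"
        using P(2)[OF x] P(3)[OF y] by (metis mult.assoc)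
      finally show ?thesis
        using imageI[OF w, of "\<lambda>x. ?tp u (?tp u x u) u"] unfolding P_def by simp
    qed
    have "?tp (?tp x u y) u z = ?tp x u (?tp y u z)" if x: "x \<in> P" and y: "y \<in> P" and z: "z \<in> P" for x y z
      unfolding prodP[OF x y] prodP[OF y z] prodP[OF inP[OF x y] z] prodP[OF x inP[OF y z]]
      by (simp add: mult.assoc)
    then show ?thesis
      using uA tripotent unfolding abelian_tripotent_def Let_def P_def[symmetric] by blast
  qed
  have full: "?A \<subseteq> J" if J: "triple_ideal ?A ?tp J" "closedin (weak_star_topology ?A ?F) J" "u \<in> J" for J
  proof -
    have JA: "J \<subseteq> ?A" "csubspace J"
      and ideal: "\<And>a b i. a \<in> ?A \<Longrightarrow> b \<in> ?A \<Longrightarrow> i \<in> J \<Longrightarrow> ?tp a b i \<in> J"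
        "\<And>a b i. a \<in> ?A \<Longrightarrow> b \<in> ?A \<Longrightarrow> i \<in> J \<Longrightarrow> ?tp a i b \<in> J"
      using J(1) by (auto simp: triple_ideal_def)
    \<comment> \<open>Pulling \<open>J\<close> back along \<open>x \<mapsto> e * x\<close> turns a
      triple ideal containing \<open>u\<close> into a Jordan ideal of the corner containing
      \<open>r\<close>.\<close>
    define K where "K = {x \<in> ?N. e * x \<in> J}"
    have "q \<in> K"
    proof (rule full_jordan_ideal[OF M qM qP])
      show "K \<subseteq> ?N"
        by (auto simp: K_def)
      show "csubspace K"
        using ncl csubspaceD[OF JA(2)]
        by (auto simp: csubspace_def K_def distrib_left scaleC_mult_right)
      show "x * y + y * x \<in> K" if x: "x \<in> K" and y: "y \<in> ?N" for x y
      proof -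
        have xN: "x \<in> ?N" "e * x \<in> J"
          using x by (auto simp: K_def)
        \<comment> \<open>With \<open>e\<close> in the middle slot the triple product is the Jordan
          product of the corner, transported by \<open>e\<close>.\<close>
        have "?tp (e * y) e (e * x) = (1 / 2) *\<^sub>R (e * (x * y + y * x))"
          unfolding tp[OF to_A[OF y] eA to_A[OF xN(1)]] cstar_triple_def
          using NM(4)[OF y] NM(4)[OF xN(1)] NM(2)[OF y] NM(2)[OF xN(1)]
          by (simp add: q_def distrib_left mult.assoc add.commute)
        then have "e * (x * y + y * x) = 2 *\<^sub>R ?tp (e * y) e (e * x)"
          by simp
        also have "\<dots> \<in> J"
          by (rule csubspaceD(4)[OF JA(2) ideal(1)[OF to_A[OF y] eA xN(2)]])
        finally show ?thesis
          using ncl(2)[OF ncl(4)[OF xN(1) y] ncl(4)[OF y xN(1)]] by (simp add: K_def)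
      qed
      show "boundedly_closed_in ?N K"
        unfolding boundedly_closed_in_def
      proof (intro allI impI)
        fix C :: real and N a
        assume *: "N \<noteq> bot \<and> eventually (\<lambda>x. x \<in> K \<and> norm x \<le> C) N \<and>
          (\<forall>v. ((\<lambda>x. bop_apply x v) \<longlongrightarrow> bop_apply a v) N) \<and> a \<in> ?N"
        have "e * a \<in> J"
        proof (rule closedin_weak_star_limit[OF csA J(2), where N=N and X="\<lambda>x. e * x"])
          have le: "norm (e * x) \<le> norm x" for x
            using norm_mult_ineq[of e x] mult_right_mono[OF norm_partial_isometry_le[OF pe] norm_ge_zero[of x]]
            by simp
          have ev: "eventually (\<lambda>x. x \<in> K \<and> norm x \<le> C) N"
            using * by blast
          from ev show "eventually (\<lambda>x. e * x \<in> J) N"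
            by eventually_elim (simp add: K_def)
          from ev show "eventually (\<lambda>x. norm (e * x) \<le> C) N"
            by eventually_elim (use le order_trans in blast)
          show "((\<lambda>x. bop_apply (e * x) v) \<longlongrightarrow> bop_apply (e * a) v) N" for v
            unfolding bop_apply_mult using * by (intro tendsto_bop_apply) blast
          show "e * a \<in> ?A"
            using * by (intro to_A) blast
          show "N \<noteq> bot"
            using * by blast
        qed
        then show "a \<in> K"
          using * by (simp add: K_def)
      qed
      show "r \<in> K"
        using rN J(3) by (simp add: K_def u_def)
    qed (use rM r(3) in simp_all)
    then have eJ: "e \<in> J"
      using eq by (simp add: K_def)
    show ?thesis
    proof
      fix a assume a: "a \<in> ?A"
      \<comment> \<open>As \<open>e\<close> is the Jordan identity, an ideal containing it is the
        whole space.\<close>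
      have "?tp a e e = a"
        using AM[OF a] by (simp add: tp[OF a eA eA] cstar_triple_def mult.assoc flip: scaleR_2)
      then show "a \<in> J"
        using ideal(1)[OF a eA eJ] by simp
    qed
  qed
  have "triple_ideal ?A ?tp ?A"
    unfolding triple_ideal_def jordan_triple_def
    by (intro conjI ballI order_refl csA csubspaceD[OF csA] prod sharp)
  moreover have "closedin (weak_star_topology ?A ?F) ?A"
  proof -
    have "(\<lambda>x. 0) \<in> ?F"
      using predA by (simp add: predual_def)
    then have "?A \<in> {{a \<in> ?A. f a \<in> U} | f U. f \<in> ?F \<and> open U}"
      by (intro CollectI exI[of _ "\<lambda>x. 0"] exI[of _ UNIV]) simp
    then have "topspace (weak_star_topology ?A ?F) = ?A"
      unfolding weak_star_topology_def topology_generated_by_topspace by blast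
    then show ?thesis
      using closedin_topspace[of "weak_star_topology ?A ?F"] by simp
  qed
  ultimately have "?A = weak_star_closed_ideal_generated ?A ?F ?tp u"
    unfolding weak_star_closed_ideal_generated_def using uA full by blast
  then show ?thesis
    unfolding type_I_JW_star_algebra_def using JW predA abelian by blast
qed

end
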